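(* Let $G$ be a group, let $R=\bigoplus_{g\in G}R_g$ be a $G$-graded ring and let $f$ be a central homogeneous idempotent of $R$. If the $G$-graded group rings $(fR)[G]$ and $((1-f)R)[G]$ are graded NR-clean, then the $G$-graded group ring $R[G]$ is graded NR-clean.
   Context: All rings are associative with unity (not necessarily commutative). A ring $R$ is $G$-graded if $R=\bigoplus_{g\in G}R_g$ with $R_g$ additive subgroups and $R_gR_h\subseteq R_{gh}$ for all $g,h\in G$. The elements of $h(R)=\bigcup_{g\in G}R_g$ are called homogeneous. A homogeneous element $r$ is graded-regular if $r=rar$ for some $a\in h(R)$; $gr(R)$ is the set of graded-regular elements and $N(R)$ is the set of nilpotent elements of $R$. A $G$-graded ring $R$ is graded NR-clean if every $x\in h(R)$ can be written $x=r+n$ with $r\in gr(R)$ and $n\in N(R)\cap h(R)$. Homogeneous idempotents lie in $R_e$, where $e$ is the identity of $G$. For a central homogeneous idempotent $f$, $fR$ is a $G$-graded ring with unity $f$ and $g$-component $fR_g$; likewise for $1-f$. For a $G$-graded ring $R$, the group ring $R[G]$ is the free left $R$-module on $G$ with multiplication determined by $(r_g g')(r_h h')=r_gr_h\,(h^{-1}g'h\,h')$ for $g,g',h,h'\in G$, $r_g\in R_g$, $r_h\in R_h$; it is $G$-graded with $g$-component $(R[G])_g=\bigoplus_{h\in G}R_{gh^{-1}}h$. *)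

theory Defs
  imports "HOL-Algebra.Algebra"
begin

text \<open>A grading of \<open>R\<close> by \<open>G\<close> is the family \<open>A\<close> of its components, of which only the values \<open>A g\<close> with \<open>g\<close> in the carrier of \<open>G\<close> matter.
  A decomposition of \<open>x\<close> is its
  expression as a finitely supported sum of elements of the components; extensionality
  outside the carrier of \<open>G\<close> makes uniqueness of \<open>u\<close> the directness of the sum.\<close>

definition is_decomposition ::
  "('g, 'm) monoid_scheme \<Rightarrow> ('a, 'n) ring_scheme \<Rightarrow> ('g \<Rightarrow> 'a set) \<Rightarrow> 'a \<Rightarrow> ('g \<Rightarrow> 'a) \<Rightarrow> bool"
  where "is_decomposition G R A x u \<longleftrightarrow>
    u \<in> (\<Pi>\<^sub>E g \<in> carrier G. A g) \<and>
    finite {g \<in> carrier G. u g \<noteq> \<zero>\<^bsub>R\<^esub>} \<and>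
    x = (\<Oplus>\<^bsub>R\<^esub>g \<in> {g \<in> carrier G. u g \<noteq> \<zero>\<^bsub>R\<^esub>}. u g)"

locale graded_ring = G?: group G + R?: ring R
  for G (structure) and R (structure) +
  fixes A
  assumes component_additive_subgroup: "g \<in> carrier G \<Longrightarrow> additive_subgroup (A g) R"
    and component_mult:
      "\<lbrakk>g \<in> carrier G; h \<in> carrier G; x \<in> A g; y \<in> A h\<rbrakk> \<Longrightarrow> x \<otimes>\<^bsub>R\<^esub> y \<in> A (g \<otimes>\<^bsub>G\<^esub> h)"
    and direct_sum: "x \<in> carrier R \<Longrightarrow> \<exists>!u. is_decomposition G R A x u"

definition component_of ::
  "('g, 'm) monoid_scheme \<Rightarrow> ('a, 'n) ring_scheme \<Rightarrow> ('g \<Rightarrow> 'a set) \<Rightarrow> 'g \<Rightarrow> 'a \<Rightarrow> 'a"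
  where "component_of G R A g x = (THE u. is_decomposition G R A x u) g"

definition homogeneous :: "('g, 'm) monoid_scheme \<Rightarrow> ('g \<Rightarrow> 'a set) \<Rightarrow> 'a set"
  where "homogeneous G A = (\<Union>g \<in> carrier G. A g)"

definition graded_regular ::
  "('g, 'm) monoid_scheme \<Rightarrow> ('a, 'n) ring_scheme \<Rightarrow> ('g \<Rightarrow> 'a set) \<Rightarrow> 'a set"
  where "graded_regular G R A =
    {r \<in> homogeneous G A. \<exists>a \<in> homogeneous G A. r = r \<otimes>\<^bsub>R\<^esub> a \<otimes>\<^bsub>R\<^esub> r}"

definition nilpotents :: "('a, 'n) ring_scheme \<Rightarrow> 'a set"
  where "nilpotents R = {x \<in> carrier R. \<exists>n::nat. x [^]\<^bsub>R\<^esub> n = \<zero>\<^bsub>R\<^esub>}"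

definition graded_NR_clean ::
  "('g, 'm) monoid_scheme \<Rightarrow> ('a, 'n) ring_scheme \<Rightarrow> ('g \<Rightarrow> 'a set) \<Rightarrow> bool"
  where "graded_NR_clean G R A \<longleftrightarrow>
    (\<forall>x \<in> homogeneous G A. \<exists>r \<in> graded_regular G R A. \<exists>n \<in> nilpotents R \<inter> homogeneous G A.
      x = r \<oplus>\<^bsub>R\<^esub> n)"

text \<open>The ring \<open>fR\<close> with unity \<open>f\<close>, for a central idempotent \<open>f\<close>, and its components \<open>fR\<^sub>g\<close>.\<close>

definition corner_ring :: "('a, 'n) ring_scheme \<Rightarrow> 'a \<Rightarrow> ('a, 'n) ring_scheme"
  where "corner_ring R f = R\<lparr>carrier := f <#\<^bsub>R\<^esub> carrier R, one := f\<rparr>"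

definition corner_component :: "('a, 'n) ring_scheme \<Rightarrow> 'a \<Rightarrow> ('g \<Rightarrow> 'a set) \<Rightarrow> 'g \<Rightarrow> 'a set"
  where "corner_component R f A g = f <#\<^bsub>R\<^esub> A g"

text \<open>An element \<open>p\<close> of the group ring is the function sending \<open>k\<close> to the coefficient of \<open>k\<close>.  The
  product extends \<open>(r\<^sub>g k) (s\<^sub>h l) = r\<^sub>g s\<^sub>h (h\<inverse> k h l)\<close> biadditively: the coefficients are split
  into their homogeneous components, and only the finitely many nonzero ones are summed.\<close>

definition group_ring ::
  "('g, 'm) monoid_scheme \<Rightarrow> ('a, 'n) ring_scheme \<Rightarrow> ('g \<Rightarrow> 'a set) \<Rightarrow> ('g \<Rightarrow> 'a) ring"
  where "group_ring G R A = \<lparr>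
    carrier = {p \<in> carrier G \<rightarrow>\<^sub>E carrier R. finite {k \<in> carrier G. p k \<noteq> \<zero>\<^bsub>R\<^esub>}},
    monoid.mult = (\<lambda>p q. \<lambda>m \<in> carrier G.
      finsum R
        (\<lambda>(g, k, h, l). component_of G R A g (p k) \<otimes>\<^bsub>R\<^esub> component_of G R A h (q l))
        {(g, k, h, l).
          g \<in> carrier G \<and> k \<in> carrier G \<and> h \<in> carrier G \<and> l \<in> carrier G \<and>
          component_of G R A g (p k) \<noteq> \<zero>\<^bsub>R\<^esub> \<and> component_of G R A h (q l) \<noteq> \<zero>\<^bsub>R\<^esub> \<and>
          inv\<^bsub>G\<^esub> h \<otimes>\<^bsub>G\<^esub> k \<otimes>\<^bsub>G\<^esub> h \<otimes>\<^bsub>G\<^esub> l = m}),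
    one = (\<lambda>k \<in> carrier G. if k = \<one>\<^bsub>G\<^esub> then \<one>\<^bsub>R\<^esub> else \<zero>\<^bsub>R\<^esub>),
    ring.zero = (\<lambda>k \<in> carrier G. \<zero>\<^bsub>R\<^esub>),
    add = (\<lambda>p q. \<lambda>k \<in> carrier G. p k \<oplus>\<^bsub>R\<^esub> q k)\<rparr>"

definition group_ring_component ::
  "('g, 'm) monoid_scheme \<Rightarrow> ('a, 'n) ring_scheme \<Rightarrow> ('g \<Rightarrow> 'a set) \<Rightarrow> 'g \<Rightarrow> ('g \<Rightarrow> 'a) set"
  where "group_ring_component G R A g =
    {p \<in> carrier (group_ring G R A). \<forall>h \<in> carrier G. p h \<in> A (g \<otimes>\<^bsub>G\<^esub> inv\<^bsub>G\<^esub> h)}"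

definition group_ring_monom ::
  "('g, 'm) monoid_scheme \<Rightarrow> ('a, 'n) ring_scheme \<Rightarrow> 'a \<Rightarrow> 'g \<Rightarrow> 'g \<Rightarrow> 'a"
  where "group_ring_monom G R r k = (\<lambda>m \<in> carrier G. if m = k then r else \<zero>\<^bsub>R\<^esub>)"

context graded_ring
begin

lemma component_of_homogeneous:
  assumes g: "g \<in> carrier G" and h: "h \<in> carrier G" and x: "x \<in> A g"
  shows "component_of G R A h x = (if h = g then x else \<zero>\<^bsub>R\<^esub>)"
proof -
  have A: "\<And>g. g \<in> carrier G \<Longrightarrow> A g \<subseteq> carrier R \<and> \<zero>\<^bsub>R\<^esub> \<in> A g"
    using component_additive_subgroup additive_subgroup.a_subset additive_subgroup.zero_closed
    by blast
  let ?u = "\<lambda>h \<in> carrier G. if h = g then x else \<zero>\<^bsub>R\<^esub>"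
  have xR: "x \<in> carrier R" using A g x by blast
  have supp: "{k \<in> carrier G. ?u k \<noteq> \<zero>\<^bsub>R\<^esub>} = (if x = \<zero>\<^bsub>R\<^esub> then {} else {g})"
    using g by auto
  have "is_decomposition G R A x ?u"
    unfolding is_decomposition_def supp using A g x xR by auto
  then have "(THE u. is_decomposition G R A x u) = ?u"
    using direct_sum[OF xR] by (rule the1_equality[rotated])
  then show ?thesis unfolding component_of_def using h by simp
qed

lemma group_ring_monom_mult:
  assumes g: "g \<in> carrier G" "k \<in> carrier G" "h \<in> carrier G" "l \<in> carrier G"
    and r: "r \<in> A g" and s: "s \<in> A h"
  shows "group_ring_monom G R r k \<otimes>\<^bsub>group_ring G R A\<^esub> group_ring_monom G R s l =
    group_ring_monom G R (r \<otimes>\<^bsub>R\<^esub> s) (inv\<^bsub>G\<^esub> h \<otimes>\<^bsub>G\<^esub> k \<otimes>\<^bsub>G\<^esub> h \<otimes>\<^bsub>G\<^esub> l)"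
proof -
  have sub: "\<And>g. g \<in> carrier G \<Longrightarrow> A g \<subseteq> carrier R \<and> \<zero>\<^bsub>R\<^esub> \<in> A g"
    using component_additive_subgroup additive_subgroup.a_subset additive_subgroup.zero_closed
    by blast
  have rs: "r \<in> carrier R" "s \<in> carrier R" using sub g r s by blast+
  have comp: "component_of G R A i (group_ring_monom G R t j m) =
      (if i = c \<and> m = j then t else \<zero>\<^bsub>R\<^esub>)"
    if "i \<in> carrier G" "m \<in> carrier G" "c \<in> carrier G" "t \<in> A c" for i m t j c
    using that component_of_homogeneous[of c i] sub
    by (auto simp: group_ring_monom_def)
  let ?c = "inv\<^bsub>G\<^esub> h \<otimes>\<^bsub>G\<^esub> k \<otimes>\<^bsub>G\<^esub> h \<otimes>\<^bsub>G\<^esub> l"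
  let ?S = "\<lambda>m. {(g', k', h', l').
          g' \<in> carrier G \<and> k' \<in> carrier G \<and> h' \<in> carrier G \<and> l' \<in> carrier G \<and>
          component_of G R A g' (group_ring_monom G R r k k') \<noteq> \<zero>\<^bsub>R\<^esub> \<and>
          component_of G R A h' (group_ring_monom G R s l l') \<noteq> \<zero>\<^bsub>R\<^esub> \<and>
          inv\<^bsub>G\<^esub> h' \<otimes>\<^bsub>G\<^esub> k' \<otimes>\<^bsub>G\<^esub> h' \<otimes>\<^bsub>G\<^esub> l' = m}"
  have S: "?S m = (if m = ?c \<and> r \<noteq> \<zero>\<^bsub>R\<^esub> \<and> s \<noteq> \<zero>\<^bsub>R\<^esub> then {(g, k, h, l)} else {})" for m
    using g by (auto simp: comp[OF _ _ g(1) r] comp[OF _ _ g(3) s] split: if_splits)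
  show ?thesis
    unfolding group_ring_def monoid.simps S
    by (rule ext) (use g rs in \<open>auto simp: group_ring_monom_def[of _ _ "r \<otimes>\<^bsub>R\<^esub> s"]
      comp[OF _ _ g(1) r] comp[OF _ _ g(3) s]\<close>)
qed

end

end

theory Submission
  imports Defs
begin

text \<open>For a central idempotent \<open>f\<close> of degree \<open>e\<close>, multiplication by \<open>f\<close> respects the grading, so
  \<open>R[G]\<close> is the direct product of the ideals \<open>(fR)[G]\<close> and \<open>((1 - f)R)[G]\<close>.  Given \<open>x\<close> homogeneous of
  degree \<open>g\<close>, decompose \<open>fx\<close> and \<open>(1 - f)x\<close> separately and add the results.  For the sums to be
  homogeneous, the regular and nilpotent parts must have degree \<open>g\<close> and the inner inverses degree
  \<open>g\<inverse>\<close>; this can be arranged since homogeneous elements of other degrees that occur in the equations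
  cancel or vanish.  Regularity and nilpotence are then checked factorwise.\<close>

section \<open>Group rings of graded rings\<close>

text \<open>The product of \<open>group_ring\<close> splits coefficients by unique decomposition in
  the coefficient ring, so products over fR and over R can be compared only once a decomposition in
  the corner is known to be the one in R. This comes from uniqueness: multiplying the decomposition
  of x = fx by f gives another decomposition of x, so all its parts are fixed by f. After that
  (fR)[G] sits inside R[G] without any embedding map: its elements are the same functions, with the
  same zero, sums and products. Only the unities differ, and f and 1 - f add up to 1. The recurring
  obstacle is that sums run over exact supports, which shrink when terms cancel. Every sum is
  therefore first moved to a larger finite index set, on which the extra terms vanish. The splitting
  of R[G] is expressed by one product rule for sums of elements of the two factors. Powers and r a r
  are bracketed to the left on both sides of it, so repeated use of this rule settles regularity and
  nilpotence.\<close>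

definition convolution_support ::
  "('g, 'm) monoid_scheme \<Rightarrow> ('a, 'n) ring_scheme \<Rightarrow> ('g \<Rightarrow> 'a set) \<Rightarrow>
    ('g \<Rightarrow> 'a) \<Rightarrow> ('g \<Rightarrow> 'a) \<Rightarrow> 'g \<Rightarrow> ('g \<times> 'g \<times> 'g \<times> 'g) set"
  where "convolution_support G R A p q m = {(g, k, h, l).
    g \<in> carrier G \<and> k \<in> carrier G \<and> h \<in> carrier G \<and> l \<in> carrier G \<and>
    component_of G R A g (p k) \<noteq> \<zero>\<^bsub>R\<^esub> \<and> component_of G R A h (q l) \<noteq> \<zero>\<^bsub>R\<^esub> \<and>
    inv\<^bsub>G\<^esub> h \<otimes>\<^bsub>G\<^esub> k \<otimes>\<^bsub>G\<^esub> h \<otimes>\<^bsub>G\<^esub> l = m}"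

text \<open>Kept apart from its index set, so that sums for different factors, or over different
  coefficient rings, can be compared on a common index set.\<close>

definition convolution_summand ::
  "('g, 'm) monoid_scheme \<Rightarrow> ('a, 'n) ring_scheme \<Rightarrow> ('g \<Rightarrow> 'a set) \<Rightarrow>
    ('g \<Rightarrow> 'a) \<Rightarrow> ('g \<Rightarrow> 'a) \<Rightarrow> 'g \<times> 'g \<times> 'g \<times> 'g \<Rightarrow> 'a"
  where "convolution_summand G R A p q =
    (\<lambda>(g, k, h, l). component_of G R A g (p k) \<otimes>\<^bsub>R\<^esub> component_of G R A h (q l))"

lemma group_ring_mult:
  "p \<otimes>\<^bsub>group_ring G R A\<^esub> q = (\<lambda>m \<in> carrier G.
    finsum R (convolution_summand G R A p q) (convolution_support G R A p q m))"
  by (simp add: group_ring_def convolution_support_def convolution_summand_def)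

lemma group_ring_carrier:
  "p \<in> carrier (group_ring G R A) \<longleftrightarrow>
    p \<in> carrier G \<rightarrow>\<^sub>E carrier R \<and> finite {k \<in> carrier G. p k \<noteq> \<zero>\<^bsub>R\<^esub>}"
  by (simp add: group_ring_def)

lemma group_ring_add:
  "p \<oplus>\<^bsub>group_ring G R A\<^esub> q = (\<lambda>k \<in> carrier G. p k \<oplus>\<^bsub>R\<^esub> q k)"
  by (simp add: group_ring_def)

lemma group_ring_zero: "\<zero>\<^bsub>group_ring G R A\<^esub> = (\<lambda>k \<in> carrier G. \<zero>\<^bsub>R\<^esub>)"
  by (simp add: group_ring_def)

lemma group_ring_one:
  "\<one>\<^bsub>group_ring G R A\<^esub> = (\<lambda>k \<in> carrier G. if k = \<one>\<^bsub>G\<^esub> then \<one>\<^bsub>R\<^esub> else \<zero>\<^bsub>R\<^esub>)"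
  by (simp add: group_ring_def)

lemma group_ring_componentD:
  assumes "p \<in> group_ring_component G R A g"
  shows "p \<in> carrier (group_ring G R A)"
    and "h \<in> carrier G \<Longrightarrow> p h \<in> A (g \<otimes>\<^bsub>G\<^esub> inv\<^bsub>G\<^esub> h)"
  using assms by (auto simp: group_ring_component_def)

lemma group_ring_eqI:
  assumes "p \<in> carrier (group_ring G R A)" "q \<in> carrier (group_ring G R A)"
    and "\<And>k. k \<in> carrier G \<Longrightarrow> p k = q k"
  shows "p = q"
  using assms by (auto simp: group_ring_carrier intro: PiE_ext)

context graded_ring
begin

section \<open>Homogeneous components and unique decompositions\<close>

lemma component_subset: "g \<in> carrier G \<Longrightarrow> A g \<subseteq> carrier R"
  using component_additive_subgroup additive_subgroup.a_subset by blast

lemma component_in_carrier: "g \<in> carrier G \<Longrightarrow> x \<in> A g \<Longrightarrow> x \<in> carrier R"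
  using component_subset by blast

lemma component_zero: "g \<in> carrier G \<Longrightarrow> \<zero>\<^bsub>R\<^esub> \<in> A g"
  using component_additive_subgroup additive_subgroup.zero_closed by blast

lemma component_add:
  "g \<in> carrier G \<Longrightarrow> x \<in> A g \<Longrightarrow> y \<in> A g \<Longrightarrow> x \<oplus>\<^bsub>R\<^esub> y \<in> A g"
  by (rule additive_subgroup.a_closed[OF component_additive_subgroup])

lemma component_minus: "g \<in> carrier G \<Longrightarrow> x \<in> A g \<Longrightarrow> \<ominus>\<^bsub>R\<^esub> x \<in> A g"
  by (rule additive_subgroup.a_inv_closed[OF component_additive_subgroup])

lemma component_finsum:
  assumes "g \<in> carrier G" "\<And>i. i \<in> S \<Longrightarrow> u i \<in> A g"
  shows "finsum R u S \<in> A g"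
  using assms(2)
proof (induction S rule: infinite_finite_induct)
  case (insert i S)
  then have "u \<in> S \<rightarrow> carrier R" "u i \<in> carrier R"
    using component_subset[OF assms(1)] by auto
  then show ?case using insert component_add[OF assms(1)] by (simp add: R.finsum_insert)
\<comment> \<open>A sum over an infinite set is zero by convention, and zero lies in every
  component.\<close>
qed (use component_zero[OF assms(1)] in \<open>simp_all add: R.finsum_infinite\<close>)

text \<open>A decomposition sums over its exact support, which is awkward to know for a constructed
  \<open>u\<close>. Any finite set containing the support will do, since the extra terms are zero;
  \<open>decomposition_finsum\<close> is the converse passage.\<close>

lemma is_decompositionI:
  assumes u: "u \<in> (\<Pi>\<^sub>E g \<in> carrier G. A g)"
    and S: "finite S" "S \<subseteq> carrier G" "\<And>g. g \<in> carrier G - S \<Longrightarrow> u g = \<zero>\<^bsub>R\<^esub>"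
    and x: "x = finsum R u S"
  shows "is_decomposition G R A x u"
proof -
  have sub: "{g \<in> carrier G. u g \<noteq> \<zero>\<^bsub>R\<^esub>} \<subseteq> S" using S(3) by blast
  have uR: "u \<in> S \<rightarrow> carrier R" using u S(2) component_in_carrier by blast
  have "finsum R u {g \<in> carrier G. u g \<noteq> \<zero>\<^bsub>R\<^esub>} = finsum R u S"
    by (rule R.add.finprod_mono_neutral_cong_left)
      (use S sub uR in auto)
  then show ?thesis
    using u x finite_subset[OF sub S(1)] unfolding is_decomposition_def by auto
qed

lemma decomposition_finsum:
  assumes d: "is_decomposition G R A x u"
    and S: "finite S" "S \<subseteq> carrier G" "{g \<in> carrier G. u g \<noteq> \<zero>\<^bsub>R\<^esub>} \<subseteq> S"
  shows "x = finsum R u S"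
proof -
  have u: "u \<in> (\<Pi>\<^sub>E g \<in> carrier G. A g)" "x = finsum R u {g \<in> carrier G. u g \<noteq> \<zero>\<^bsub>R\<^esub>}"
    using d by (auto simp: is_decomposition_def)
  have "finsum R u {g \<in> carrier G. u g \<noteq> \<zero>\<^bsub>R\<^esub>} = finsum R u S"
    by (rule R.add.finprod_mono_neutral_cong_left)
      (use S u component_in_carrier in \<open>auto simp: PiE_iff subset_iff\<close>)
  then show ?thesis using u by simp
qed

lemma component_of_eq:
  assumes "x \<in> carrier R" "is_decomposition G R A x u"
  shows "component_of G R A g x = u g"
proof -
  have "(THE u. is_decomposition G R A x u) = u"
    using assms(2) direct_sum[OF assms(1)] by (rule the1_equality[rotated])
  then show ?thesis by (simp add: component_of_def)
qed

lemma decomposition_component_of: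
  assumes "x \<in> carrier R"
  shows "is_decomposition G R A x (\<lambda>g. component_of G R A g x)"
  using theI'[OF direct_sum[OF assms]] by (simp add: component_of_def)

lemma component_of_in:
  "x \<in> carrier R \<Longrightarrow> g \<in> carrier G \<Longrightarrow> component_of G R A g x \<in> A g"
  using decomposition_component_of[of x] by (auto simp: is_decomposition_def PiE_iff)

lemma component_of_closed:
  "x \<in> carrier R \<Longrightarrow> g \<in> carrier G \<Longrightarrow> component_of G R A g x \<in> carrier R"
  using component_of_in component_in_carrier by blast

lemma finite_component_of:
  "x \<in> carrier R \<Longrightarrow> finite {g \<in> carrier G. component_of G R A g x \<noteq> \<zero>\<^bsub>R\<^esub>}"
  using decomposition_component_of[of x] by (auto simp: is_decomposition_def)

lemma component_of_zero: "g \<in> carrier G \<Longrightarrow> component_of G R A g \<zero>\<^bsub>R\<^esub> = \<zero>\<^bsub>R\<^esub>"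
  using component_of_homogeneous[of g g] component_zero[of g] by simp

text \<open>Adding two decompositions termwise decomposes the sum, and uniqueness does the rest. The
  union of the two supports serves as index set, because parts may cancel.\<close>

lemma component_of_add:
  assumes x: "x \<in> carrier R" and y: "y \<in> carrier R" and g: "g \<in> carrier G"
  shows "component_of G R A g (x \<oplus>\<^bsub>R\<^esub> y) =
    component_of G R A g x \<oplus>\<^bsub>R\<^esub> component_of G R A g y"
proof -
  let ?u = "\<lambda>g. component_of G R A g x" and ?v = "\<lambda>g. component_of G R A g y"
  let ?w = "\<lambda>g \<in> carrier G. ?u g \<oplus>\<^bsub>R\<^esub> ?v g"
  let ?S = "{g \<in> carrier G. ?u g \<noteq> \<zero>\<^bsub>R\<^esub>} \<union> {g \<in> carrier G. ?v g \<noteq> \<zero>\<^bsub>R\<^esub>}"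
  have S: "finite ?S" using finite_component_of x y by simp
  have uv: "?u \<in> ?S \<rightarrow> carrier R" "?v \<in> ?S \<rightarrow> carrier R"
    using component_of_closed x y by auto
  have "x = finsum R ?u ?S"
    by (rule decomposition_finsum[OF decomposition_component_of[OF x] S]) auto
  moreover have "y = finsum R ?v ?S"
    by (rule decomposition_finsum[OF decomposition_component_of[OF y] S]) auto
  ultimately have "x \<oplus>\<^bsub>R\<^esub> y = finsum R ?u ?S \<oplus>\<^bsub>R\<^esub> finsum R ?v ?S" by simp
  also have "\<dots> = finsum R (\<lambda>g. ?u g \<oplus>\<^bsub>R\<^esub> ?v g) ?S"
    by (rule R.finsum_addf[symmetric]) (use uv in auto)
  also have "\<dots> = finsum R ?w ?S"
    by (rule R.finsum_cong') (use component_of_closed x y in \<open>auto\<close>)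
  finally have sum: "x \<oplus>\<^bsub>R\<^esub> y = finsum R ?w ?S" .
  have "is_decomposition G R A (x \<oplus>\<^bsub>R\<^esub> y) ?w"
    by (rule is_decompositionI[OF _ S _ _ sum])
      (use component_of_in component_add x y in \<open>auto\<close>)
  from component_of_eq[OF _ this] show ?thesis using x y g by simp
qed

text \<open>The part of \<open>x\<close> of degree \<open>g\<close> can be read off from either
  membership: one gives \<open>x\<close>, the other zero.\<close>

lemma component_inter_trivial:
  assumes "g \<in> carrier G" "h \<in> carrier G" "g \<noteq> h" "x \<in> A g" "x \<in> A h"
  shows "x = \<zero>\<^bsub>R\<^esub>"
  using component_of_homogeneous[of g g x] component_of_homogeneous[of h g x] assms by simp

section \<open>The convolution product, its finiteness and its degrees\<close>

lemma finite_convolution_support: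
  assumes p: "p \<in> carrier (group_ring G R A)" and q: "q \<in> carrier (group_ring G R A)"
  shows "finite (\<Union>m. convolution_support G R A p q m)"
proof -
  \<comment> \<open>The group element \<open>k\<close> ranges over the finite support of
    \<open>p\<close>, and each coefficient has finitely many nonzero parts. Bounding the quadruples
    for all \<open>m\<close> together gives both finite sums and finite support of the
    product.\<close>
  have fin: "finite {(g, k). g \<in> carrier G \<and> k \<in> carrier G \<and> component_of G R A g (p k) \<noteq> \<zero>\<^bsub>R\<^esub>}"
    if p: "p \<in> carrier (group_ring G R A)" for p
  proof (rule finite_subset)
    let ?K = "{k \<in> carrier G. p k \<noteq> \<zero>\<^bsub>R\<^esub>}"
    let ?S = "\<Union>k \<in> ?K. (\<lambda>g. (g, k)) ` {g \<in> carrier G. component_of G R A g (p k) \<noteq> \<zero>\<^bsub>R\<^esub>}"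
    show "{(g, k). g \<in> carrier G \<and> k \<in> carrier G \<and> component_of G R A g (p k) \<noteq> \<zero>\<^bsub>R\<^esub>} \<subseteq> ?S"
      using component_of_zero by (auto intro!: imageI)
    show "finite ?S" using p finite_component_of by (auto simp: group_ring_carrier PiE_iff)
  qed
  show ?thesis
    by (rule finite_subset[OF _ finite_imageI[OF finite_cartesian_product[OF fin[OF p] fin[OF q]],
      of "\<lambda>((g, k), (h, l)). (g, k, h, l)"]])
      (force simp: convolution_support_def)
qed

lemma convolution_summand_in:
  assumes "p \<in> carrier G \<rightarrow> carrier R" "q \<in> carrier G \<rightarrow> carrier R"
    and "g \<in> carrier G" "k \<in> carrier G" "h \<in> carrier G" "l \<in> carrier G"
  shows "convolution_summand G R A p q (g, k, h, l) \<in> A (g \<otimes>\<^bsub>G\<^esub> h)"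
  unfolding convolution_summand_def using assms by (auto intro!: component_mult component_of_in)

lemma convolution_summand_closed:
  assumes "p \<in> carrier G \<rightarrow> carrier R" "q \<in> carrier G \<rightarrow> carrier R"
    and "g \<in> carrier G" "k \<in> carrier G" "h \<in> carrier G" "l \<in> carrier G"
  shows "convolution_summand G R A p q (g, k, h, l) \<in> carrier R"
  using convolution_summand_in[OF assms] component_in_carrier assms by blast

lemma group_ring_mult_closed:
  assumes p: "p \<in> carrier (group_ring G R A)" and q: "q \<in> carrier (group_ring G R A)"
  shows "p \<otimes>\<^bsub>group_ring G R A\<^esub> q \<in> carrier (group_ring G R A)"
proof -
  have pq: "p \<in> carrier G \<rightarrow> carrier R" "q \<in> carrier G \<rightarrow> carrier R"
    using p q by (auto simp: group_ring_carrier)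
  \<comment> \<open>A nonzero coefficient at \<open>m\<close> forces a nonempty sum, so
    \<open>m\<close> is determined by one of finitely many quadruples.\<close>
  have "{m \<in> carrier G. (p \<otimes>\<^bsub>group_ring G R A\<^esub> q) m \<noteq> \<zero>\<^bsub>R\<^esub>}
      \<subseteq> (\<lambda>(g, k, h, l). inv\<^bsub>G\<^esub> h \<otimes>\<^bsub>G\<^esub> k \<otimes>\<^bsub>G\<^esub> h \<otimes>\<^bsub>G\<^esub> l) `
        (\<Union>m. convolution_support G R A p q m)"
  proof
    fix m assume "m \<in> {m \<in> carrier G. (p \<otimes>\<^bsub>group_ring G R A\<^esub> q) m \<noteq> \<zero>\<^bsub>R\<^esub>}"
    then have "convolution_support G R A p q m \<noteq> {}" by (auto simp: group_ring_mult)
    then show "m \<in> (\<lambda>(g, k, h, l). inv\<^bsub>G\<^esub> h \<otimes>\<^bsub>G\<^esub> k \<otimes>\<^bsub>G\<^esub> h \<otimes>\<^bsub>G\<^esub> l) `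
        (\<Union>m. convolution_support G R A p q m)"
      by (force simp: convolution_support_def)
  qed
  then have "finite {m \<in> carrier G. (p \<otimes>\<^bsub>group_ring G R A\<^esub> q) m \<noteq> \<zero>\<^bsub>R\<^esub>}"
    using finite_convolution_support[OF p q] finite_surj by blast
  moreover have "finsum R (convolution_summand G R A p q) (convolution_support G R A p q m) \<in> carrier R"
    for m
    by (rule R.finsum_closed)
      (auto simp: convolution_support_def intro!: convolution_summand_closed pq)
  ultimately show ?thesis by (auto simp: group_ring_carrier group_ring_mult)
qed

lemma group_ring_zero_closed: "\<zero>\<^bsub>group_ring G R A\<^esub> \<in> carrier (group_ring G R A)"
  by (auto simp: group_ring_carrier group_ring_zero cong: conj_cong)

lemma group_ring_one_closed: "\<one>\<^bsub>group_ring G R A\<^esub> \<in> carrier (group_ring G R A)"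
proof -
  have "{k \<in> carrier G. \<one>\<^bsub>group_ring G R A\<^esub> k \<noteq> \<zero>\<^bsub>R\<^esub>} \<subseteq> {\<one>\<^bsub>G\<^esub>}"
    by (auto simp: group_ring_one)
  then show ?thesis
    using finite_subset by (auto simp: group_ring_carrier group_ring_one)
qed

lemma group_ring_add_closed:
  assumes p: "p \<in> carrier (group_ring G R A)" and q: "q \<in> carrier (group_ring G R A)"
  shows "p \<oplus>\<^bsub>group_ring G R A\<^esub> q \<in> carrier (group_ring G R A)"
proof -
  have "finite {k \<in> carrier G. p k \<oplus>\<^bsub>R\<^esub> q k \<noteq> \<zero>\<^bsub>R\<^esub>}"
  proof (rule finite_subset)
    show "{k \<in> carrier G. p k \<oplus>\<^bsub>R\<^esub> q k \<noteq> \<zero>\<^bsub>R\<^esub>} \<subseteq>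
        {k \<in> carrier G. p k \<noteq> \<zero>\<^bsub>R\<^esub>} \<union> {k \<in> carrier G. q k \<noteq> \<zero>\<^bsub>R\<^esub>}"
      by auto
  qed (use p q in \<open>simp add: group_ring_carrier\<close>)
  then show ?thesis using p q
    by (auto simp: group_ring_carrier group_ring_add PiE_iff cong: conj_cong)
qed

lemma group_ring_pow_closed:
  "p \<in> carrier (group_ring G R A) \<Longrightarrow>
    p [^]\<^bsub>group_ring G R A\<^esub> (n::nat) \<in> carrier (group_ring G R A)"
  by (induction n) (auto simp: nat_pow_def group_ring_one_closed group_ring_mult_closed)

lemma group_ring_zero_mult:
  "\<zero>\<^bsub>group_ring G R A\<^esub> \<otimes>\<^bsub>group_ring G R A\<^esub> q = \<zero>\<^bsub>group_ring G R A\<^esub>"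
proof -
  have "convolution_support G R A \<zero>\<^bsub>group_ring G R A\<^esub> q m = {}" for m
    using component_of_zero by (auto simp: convolution_support_def group_ring_zero)
  then show ?thesis by (simp add: group_ring_mult group_ring_zero)
qed

lemma group_ring_mult_zero:
  "p \<otimes>\<^bsub>group_ring G R A\<^esub> \<zero>\<^bsub>group_ring G R A\<^esub> = \<zero>\<^bsub>group_ring G R A\<^esub>"
proof -
  have "convolution_support G R A p \<zero>\<^bsub>group_ring G R A\<^esub> m = {}" for m
    using component_of_zero by (auto simp: convolution_support_def group_ring_zero)
  then show ?thesis by (simp add: group_ring_mult group_ring_zero)
qed

lemma group_ring_zero_component:
  "g \<in> carrier G \<Longrightarrow> \<zero>\<^bsub>group_ring G R A\<^esub> \<in> group_ring_component G R A g"
  using group_ring_zero_closed component_zero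
  by (auto simp: group_ring_component_def group_ring_zero)

lemma group_ring_add_component:
  assumes "g \<in> carrier G" "p \<in> group_ring_component G R A g" "q \<in> group_ring_component G R A g"
  shows "p \<oplus>\<^bsub>group_ring G R A\<^esub> q \<in> group_ring_component G R A g"
  using assms group_ring_add_closed[of p q] component_add
  by (auto simp: group_ring_component_def group_ring_add)

text \<open>The conjugation in the product is what makes degrees multiply: a term r_g k has degree
  gk, and the product of r_g k and s_h l has degree gh(h^-1 k h l) = (gk)(hl).\<close>

lemma group_ring_component_mult:
  assumes a: "a \<in> carrier G" and b: "b \<in> carrier G"
    and p: "p \<in> group_ring_component G R A a" and q: "q \<in> group_ring_component G R A b"
  shows "p \<otimes>\<^bsub>group_ring G R A\<^esub> q \<in> group_ring_component G R A (a \<otimes>\<^bsub>G\<^esub> b)"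
proof -
  note pc = group_ring_componentD(1)[OF p] and qc = group_ring_componentD(1)[OF q]
  have pq: "p \<in> carrier G \<rightarrow> carrier R" "q \<in> carrier G \<rightarrow> carrier R"
    using pc qc by (auto simp: group_ring_carrier)
  \<comment> \<open>Each coefficient of a homogeneous element is itself homogeneous, so only one of
    its parts can be nonzero.\<close>
  have deg: "g = c \<otimes>\<^bsub>G\<^esub> inv\<^bsub>G\<^esub> k"
    if "s \<in> group_ring_component G R A c" "c \<in> carrier G" "g \<in> carrier G" "k \<in> carrier G"
      "component_of G R A g (s k) \<noteq> \<zero>\<^bsub>R\<^esub>" for s c g k
    using that component_of_homogeneous[OF _ that(3) group_ring_componentD(2)[OF that(1) that(4)]]
    by (auto split: if_splits)
  have "finsum R (convolution_summand G R A p q) (convolution_support G R A p q m)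
      \<in> A (a \<otimes>\<^bsub>G\<^esub> b \<otimes>\<^bsub>G\<^esub> inv\<^bsub>G\<^esub> m)" if m: "m \<in> carrier G" for m
  proof (rule component_finsum)
    show "a \<otimes>\<^bsub>G\<^esub> b \<otimes>\<^bsub>G\<^esub> inv\<^bsub>G\<^esub> m \<in> carrier G" using a b m by simp
    fix i assume "i \<in> convolution_support G R A p q m"
    then obtain g k h l where i: "i = (g, k, h, l)"
      and c: "g \<in> carrier G" "k \<in> carrier G" "h \<in> carrier G" "l \<in> carrier G"
      and nz: "component_of G R A g (p k) \<noteq> \<zero>\<^bsub>R\<^esub>" "component_of G R A h (q l) \<noteq> \<zero>\<^bsub>R\<^esub>"
      and m_eq: "m = inv\<^bsub>G\<^esub> h \<otimes>\<^bsub>G\<^esub> k \<otimes>\<^bsub>G\<^esub> h \<otimes>\<^bsub>G\<^esub> l"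
      by (auto simp: convolution_support_def)
    have g: "a = g \<otimes>\<^bsub>G\<^esub> k" using deg[OF p a c(1,2) nz(1)] a c by (simp add: G.m_assoc)
    have h: "b = h \<otimes>\<^bsub>G\<^esub> l" using deg[OF q b c(3,4) nz(2)] b c by (simp add: G.m_assoc)
    have "g \<otimes>\<^bsub>G\<^esub> h \<otimes>\<^bsub>G\<^esub> m = a \<otimes>\<^bsub>G\<^esub> b"
      unfolding m_eq g h using c by (simp add: G.m_assoc G.inv_solve_left' flip: G.m_assoc[of h "inv\<^bsub>G\<^esub> h"])
    then have "a \<otimes>\<^bsub>G\<^esub> b \<otimes>\<^bsub>G\<^esub> inv\<^bsub>G\<^esub> m = g \<otimes>\<^bsub>G\<^esub> h"
      using c m a b by (metis G.inv_solve_right G.m_closed)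
    then show "convolution_summand G R A p q i \<in> A (a \<otimes>\<^bsub>G\<^esub> b \<otimes>\<^bsub>G\<^esub> inv\<^bsub>G\<^esub> m)"
      using convolution_summand_in[OF pq c] i by simp
  qed
  then show ?thesis
    using group_ring_mult_closed[OF pc qc] by (auto simp: group_ring_component_def group_ring_mult)
qed

lemma group_ring_component_inter_trivial:
  assumes g: "g \<in> carrier G" and h: "h \<in> carrier G" and "g \<noteq> h"
    and p: "p \<in> group_ring_component G R A g" "p \<in> group_ring_component G R A h"
  shows "p = \<zero>\<^bsub>group_ring G R A\<^esub>"
proof (rule group_ring_eqI)
  fix k assume k: "k \<in> carrier G"
  have "g \<otimes>\<^bsub>G\<^esub> inv\<^bsub>G\<^esub> k \<noteq> h \<otimes>\<^bsub>G\<^esub> inv\<^bsub>G\<^esub> k" using assms k by simp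
  then have "p k = \<zero>\<^bsub>R\<^esub>"
    using component_inter_trivial[OF _ _ _ group_ring_componentD(2)[OF p(1) k]
      group_ring_componentD(2)[OF p(2) k]] g h k by simp
  then show "p k = \<zero>\<^bsub>group_ring G R A\<^esub> k" using k by (simp add: group_ring_zero)
qed (use group_ring_componentD(1)[OF p(1)] group_ring_zero_closed in auto)

section \<open>Biadditivity of the product\<close>

lemma convolution_support_subset:
  "convolution_support G R A p q m \<subseteq> (carrier G \<times> carrier G \<times> carrier G \<times> carrier G) \<inter>
    {(g, k, h, l). inv\<^bsub>G\<^esub> h \<otimes>\<^bsub>G\<^esub> k \<otimes>\<^bsub>G\<^esub> h \<otimes>\<^bsub>G\<^esub> l = m}"
  by (auto simp: convolution_support_def)

text \<open>At an index of \<open>W\<close> outside the support one of the two parts is zero, hence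
  so is the summand. This allows several products to be summed over one common
  \<open>W\<close>.\<close>

lemma group_ring_mult_eq_finsum:
  assumes p: "p \<in> carrier (group_ring G R A)" and q: "q \<in> carrier (group_ring G R A)"
    and W: "finite W" "convolution_support G R A p q m \<subseteq> W"
      "W \<subseteq> (carrier G \<times> carrier G \<times> carrier G \<times> carrier G) \<inter>
        {(g, k, h, l). inv\<^bsub>G\<^esub> h \<otimes>\<^bsub>G\<^esub> k \<otimes>\<^bsub>G\<^esub> h \<otimes>\<^bsub>G\<^esub> l = m}"
    and m: "m \<in> carrier G"
  shows "(p \<otimes>\<^bsub>group_ring G R A\<^esub> q) m = finsum R (convolution_summand G R A p q) W"
proof -
  have pq: "p \<in> carrier G \<rightarrow> carrier R" "q \<in> carrier G \<rightarrow> carrier R"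
    using p q by (auto simp: group_ring_carrier)
  have "finsum R (convolution_summand G R A p q) (convolution_support G R A p q m) =
      finsum R (convolution_summand G R A p q) W"
  proof (rule R.add.finprod_mono_neutral_cong_left[OF W(1,2)])
    fix i assume i: "i \<in> W - convolution_support G R A p q m"
    obtain g k h l where ieq: "i = (g, k, h, l)" by (cases i)
    have c: "g \<in> carrier G" "k \<in> carrier G" "h \<in> carrier G" "l \<in> carrier G"
      "inv\<^bsub>G\<^esub> h \<otimes>\<^bsub>G\<^esub> k \<otimes>\<^bsub>G\<^esub> h \<otimes>\<^bsub>G\<^esub> l = m"
      using W(3) i ieq by auto
    then have "component_of G R A g (p k) = \<zero>\<^bsub>R\<^esub> \<or> component_of G R A h (q l) = \<zero>\<^bsub>R\<^esub>"
      using i ieq by (auto simp: convolution_support_def)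
    moreover have "component_of G R A g (p k) \<in> carrier R" "component_of G R A h (q l) \<in> carrier R"
      using component_of_closed pq c by auto
    ultimately show "convolution_summand G R A p q i = \<zero>\<^bsub>R\<^esub>"
      by (auto simp: ieq convolution_summand_def)
  next
    show "convolution_summand G R A p q \<in> W \<rightarrow> carrier R"
      using W(3) convolution_summand_closed[OF pq] by auto
  qed simp
  then show ?thesis using m by (simp add: group_ring_mult)
qed

lemma finite_convolution_support_at:
  "p \<in> carrier (group_ring G R A) \<Longrightarrow> q \<in> carrier (group_ring G R A) \<Longrightarrow>
    finite (convolution_support G R A p q m)"
  by (rule finite_subset[OF _ finite_convolution_support[of p q]]) auto

lemma group_ring_l_distr:
  assumes p: "p \<in> carrier (group_ring G R A)" and p': "p' \<in> carrier (group_ring G R A)"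
    and q: "q \<in> carrier (group_ring G R A)"
  shows "(p \<oplus>\<^bsub>group_ring G R A\<^esub> p') \<otimes>\<^bsub>group_ring G R A\<^esub> q =
    (p \<otimes>\<^bsub>group_ring G R A\<^esub> q) \<oplus>\<^bsub>group_ring G R A\<^esub> (p' \<otimes>\<^bsub>group_ring G R A\<^esub> q)"
    (is "?s \<otimes>\<^bsub>_\<^esub> q = ?t")
proof (rule group_ring_eqI)
  note s = group_ring_add_closed[OF p p']
  show "?s \<otimes>\<^bsub>group_ring G R A\<^esub> q \<in> carrier (group_ring G R A)"
    using s q by (rule group_ring_mult_closed)
  show "?t \<in> carrier (group_ring G R A)"
    by (intro group_ring_add_closed group_ring_mult_closed p p' q)
  have cl: "p \<in> carrier G \<rightarrow> carrier R" "p' \<in> carrier G \<rightarrow> carrier R" "q \<in> carrier G \<rightarrow> carrier R"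
    using p p' q by (auto simp: group_ring_carrier)
  have split: "component_of G R A g (?s k) =
      component_of G R A g (p k) \<oplus>\<^bsub>R\<^esub> component_of G R A g (p' k)"
    if "g \<in> carrier G" "k \<in> carrier G" for g k
    using component_of_add[of "p k" "p' k" g] cl that by (simp add: group_ring_add Pi_iff)
  fix m assume m: "m \<in> carrier G"
  \<comment> \<open>A common index set for all three products: cancellation between \<open>p\<close>
    and \<open>p'\<close> can only remove quadruples from it.\<close>
  let ?W = "convolution_support G R A p q m \<union> convolution_support G R A p' q m"
  have W: "finite ?W" using finite_convolution_support_at p p' q by blast
  have Wc: "?W \<subseteq> (carrier G \<times> carrier G \<times> carrier G \<times> carrier G) \<inter>
      {(g, k, h, l). inv\<^bsub>G\<^esub> h \<otimes>\<^bsub>G\<^esub> k \<otimes>\<^bsub>G\<^esub> h \<otimes>\<^bsub>G\<^esub> l = m}"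
    using convolution_support_subset by blast
  have Ws: "convolution_support G R A ?s q m \<subseteq> ?W"
    by (auto simp: convolution_support_def split)
  have fc: "convolution_summand G R A p q \<in> ?W \<rightarrow> carrier R"
    "convolution_summand G R A p' q \<in> ?W \<rightarrow> carrier R"
    using Wc convolution_summand_closed cl by (auto simp: subset_iff)
  have "(?s \<otimes>\<^bsub>group_ring G R A\<^esub> q) m = finsum R (convolution_summand G R A ?s q) ?W"
    using group_ring_mult_eq_finsum[OF s q W Ws Wc m] .
  also have "\<dots> = finsum R (\<lambda>i. convolution_summand G R A p q i \<oplus>\<^bsub>R\<^esub> convolution_summand G R A p' q i) ?W"
  proof (rule R.finsum_cong'[OF refl])
    fix i assume "i \<in> ?W"
    then obtain g k h l where i: "i = (g, k, h, l)"
      and c: "g \<in> carrier G" "k \<in> carrier G" "h \<in> carrier G" "l \<in> carrier G"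
      using Wc by blast
    have "component_of G R A g (p k) \<in> carrier R" "component_of G R A g (p' k) \<in> carrier R"
      "component_of G R A h (q l) \<in> carrier R"
      using component_of_closed cl c by (simp_all add: Pi_iff)
    then show "convolution_summand G R A ?s q i =
        convolution_summand G R A p q i \<oplus>\<^bsub>R\<^esub> convolution_summand G R A p' q i"
      using c by (simp add: i convolution_summand_def split R.l_distr)
  qed (use fc in auto)
  also have "\<dots> = finsum R (convolution_summand G R A p q) ?W \<oplus>\<^bsub>R\<^esub> finsum R (convolution_summand G R A p' q) ?W"
    using fc by (rule R.finsum_addf)
  also have "\<dots> = ?t m"
    using group_ring_mult_eq_finsum[OF p q W Un_upper1 Wc m]
      group_ring_mult_eq_finsum[OF p' q W Un_upper2 Wc m] m by (simp add: group_ring_add)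
  finally show "(?s \<otimes>\<^bsub>group_ring G R A\<^esub> q) m = ?t m" .
qed

lemma group_ring_r_distr:
  assumes p: "p \<in> carrier (group_ring G R A)" and p': "p' \<in> carrier (group_ring G R A)"
    and q: "q \<in> carrier (group_ring G R A)"
  shows "q \<otimes>\<^bsub>group_ring G R A\<^esub> (p \<oplus>\<^bsub>group_ring G R A\<^esub> p') =
    (q \<otimes>\<^bsub>group_ring G R A\<^esub> p) \<oplus>\<^bsub>group_ring G R A\<^esub> (q \<otimes>\<^bsub>group_ring G R A\<^esub> p')"
    (is "q \<otimes>\<^bsub>_\<^esub> ?s = ?t")
proof (rule group_ring_eqI)
  note s = group_ring_add_closed[OF p p']
  show "q \<otimes>\<^bsub>group_ring G R A\<^esub> ?s \<in> carrier (group_ring G R A)"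
    using q s by (rule group_ring_mult_closed)
  show "?t \<in> carrier (group_ring G R A)"
    by (intro group_ring_add_closed group_ring_mult_closed p p' q)
  have cl: "p \<in> carrier G \<rightarrow> carrier R" "p' \<in> carrier G \<rightarrow> carrier R" "q \<in> carrier G \<rightarrow> carrier R"
    using p p' q by (auto simp: group_ring_carrier)
  have split: "component_of G R A g (?s k) =
      component_of G R A g (p k) \<oplus>\<^bsub>R\<^esub> component_of G R A g (p' k)"
    if "g \<in> carrier G" "k \<in> carrier G" for g k
    using component_of_add[of "p k" "p' k" g] cl that by (simp add: group_ring_add Pi_iff)
  fix m assume m: "m \<in> carrier G"
  let ?W = "convolution_support G R A q p m \<union> convolution_support G R A q p' m"
  have W: "finite ?W" using finite_convolution_support_at p p' q by blast
  have Wc: "?W \<subseteq> (carrier G \<times> carrier G \<times> carrier G \<times> carrier G) \<inter>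
      {(g, k, h, l). inv\<^bsub>G\<^esub> h \<otimes>\<^bsub>G\<^esub> k \<otimes>\<^bsub>G\<^esub> h \<otimes>\<^bsub>G\<^esub> l = m}"
    using convolution_support_subset by blast
  have Ws: "convolution_support G R A q ?s m \<subseteq> ?W"
    by (auto simp: convolution_support_def split)
  have fc: "convolution_summand G R A q p \<in> ?W \<rightarrow> carrier R"
    "convolution_summand G R A q p' \<in> ?W \<rightarrow> carrier R"
    using Wc convolution_summand_closed cl by (auto simp: subset_iff)
  have "(q \<otimes>\<^bsub>group_ring G R A\<^esub> ?s) m = finsum R (convolution_summand G R A q ?s) ?W"
    using group_ring_mult_eq_finsum[OF q s W Ws Wc m] .
  also have "\<dots> = finsum R (\<lambda>i. convolution_summand G R A q p i \<oplus>\<^bsub>R\<^esub> convolution_summand G R A q p' i) ?W"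
  proof (rule R.finsum_cong'[OF refl])
    fix i assume "i \<in> ?W"
    then obtain g k h l where i: "i = (g, k, h, l)"
      and c: "g \<in> carrier G" "k \<in> carrier G" "h \<in> carrier G" "l \<in> carrier G"
      using Wc by blast
    have "component_of G R A h (p l) \<in> carrier R" "component_of G R A h (p' l) \<in> carrier R"
      "component_of G R A g (q k) \<in> carrier R"
      using component_of_closed cl c by (simp_all add: Pi_iff)
    then show "convolution_summand G R A q ?s i =
        convolution_summand G R A q p i \<oplus>\<^bsub>R\<^esub> convolution_summand G R A q p' i"
      using c by (simp add: i convolution_summand_def split R.r_distr)
  qed (use fc in auto)
  also have "\<dots> = finsum R (convolution_summand G R A q p) ?W \<oplus>\<^bsub>R\<^esub> finsum R (convolution_summand G R A q p') ?W"
    using fc by (rule R.finsum_addf)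
  also have "\<dots> = ?t m"
    using group_ring_mult_eq_finsum[OF q p W Un_upper1 Wc m]
      group_ring_mult_eq_finsum[OF q p' W Un_upper2 Wc m] m by (simp add: group_ring_add)
  finally show "(q \<otimes>\<^bsub>group_ring G R A\<^esub> ?s) m = ?t m" .
qed

section \<open>Zero, nilpotence and the degrees of summands\<close>

lemma group_ring_add_zero:
  assumes "p \<in> carrier (group_ring G R A)"
  shows "p \<oplus>\<^bsub>group_ring G R A\<^esub> \<zero>\<^bsub>group_ring G R A\<^esub> = p"
    and "\<zero>\<^bsub>group_ring G R A\<^esub> \<oplus>\<^bsub>group_ring G R A\<^esub> p = p"
proof -
  show "p \<oplus>\<^bsub>group_ring G R A\<^esub> \<zero>\<^bsub>group_ring G R A\<^esub> = p"
    by (rule group_ring_eqI[OF group_ring_add_closed[OF assms group_ring_zero_closed] assms])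
      (use assms in \<open>simp add: group_ring_add group_ring_zero group_ring_carrier PiE_iff\<close>)
  show "\<zero>\<^bsub>group_ring G R A\<^esub> \<oplus>\<^bsub>group_ring G R A\<^esub> p = p"
    by (rule group_ring_eqI[OF group_ring_add_closed[OF group_ring_zero_closed assms] assms])
      (use assms in \<open>simp add: group_ring_add group_ring_zero group_ring_carrier PiE_iff\<close>)
qed

lemma group_ring_add_comm:
  assumes "p \<in> carrier (group_ring G R A)" "q \<in> carrier (group_ring G R A)"
  shows "p \<oplus>\<^bsub>group_ring G R A\<^esub> q = q \<oplus>\<^bsub>group_ring G R A\<^esub> p"
  using assms by (auto simp: group_ring_add group_ring_carrier PiE_iff R.a_comm intro!: restrict_ext)

text \<open>Serves to bring two nilpotent elements to a common exponent. Powers grow by a factor on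
  the right, so zero persists.\<close>

lemma group_ring_nilpotent_add:
  assumes "p \<in> carrier (group_ring G R A)"
    and "p [^]\<^bsub>group_ring G R A\<^esub> (n::nat) = \<zero>\<^bsub>group_ring G R A\<^esub>"
  shows "p [^]\<^bsub>group_ring G R A\<^esub> (n + k) = \<zero>\<^bsub>group_ring G R A\<^esub>"
  using assms by (induction k) (auto simp: nat_pow_def group_ring_zero_mult)

text \<open>Compare the parts of degree g k^-1 of the coefficients at \<open>k\<close>:
  \<open>q\<close> contributes nothing there, and the sum has none because its degree is
  \<open>c\<close>. What remains is the coefficient of \<open>p\<close>.\<close>

lemma group_ring_summand_zero:
  assumes g: "g \<in> carrier G" "h \<in> carrier G" "c \<in> carrier G" "g \<noteq> h" "g \<noteq> c"
    and p: "p \<in> group_ring_component G R A g" and q: "q \<in> group_ring_component G R A h"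
    and pq: "p \<oplus>\<^bsub>group_ring G R A\<^esub> q \<in> group_ring_component G R A c"
  shows "p = \<zero>\<^bsub>group_ring G R A\<^esub>"
proof (rule group_ring_eqI)
  fix k assume k: "k \<in> carrier G"
  let ?d = "g \<otimes>\<^bsub>G\<^esub> inv\<^bsub>G\<^esub> k"
  have d: "?d \<in> carrier G" "h \<otimes>\<^bsub>G\<^esub> inv\<^bsub>G\<^esub> k \<in> carrier G" "c \<otimes>\<^bsub>G\<^esub> inv\<^bsub>G\<^esub> k \<in> carrier G"
    "?d \<noteq> h \<otimes>\<^bsub>G\<^esub> inv\<^bsub>G\<^esub> k" "?d \<noteq> c \<otimes>\<^bsub>G\<^esub> inv\<^bsub>G\<^esub> k"
    using g k by auto
  note pk = group_ring_componentD(2)[OF p k] and qk = group_ring_componentD(2)[OF q k]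
  have sum: "p k \<oplus>\<^bsub>R\<^esub> q k \<in> A (c \<otimes>\<^bsub>G\<^esub> inv\<^bsub>G\<^esub> k)"
    using group_ring_componentD(2)[OF pq k] k by (simp add: group_ring_add)
  have R: "p k \<in> carrier R" "q k \<in> carrier R"
    using pk qk d component_in_carrier by blast+
  have "\<zero>\<^bsub>R\<^esub> = component_of G R A ?d (p k \<oplus>\<^bsub>R\<^esub> q k)"
    using component_of_homogeneous[OF d(3,1) sum] d by simp
  also have "\<dots> = p k"
    using component_of_add[OF R d(1)] component_of_homogeneous[OF d(1,1) pk]
      component_of_homogeneous[OF d(2,1) qk] d R by simp
  finally show "p k = \<zero>\<^bsub>group_ring G R A\<^esub> k" using k by (simp add: group_ring_zero)
qed (use group_ring_componentD(1)[OF p] group_ring_zero_closed in auto)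

lemma group_ring_zero_nilpotent: "\<zero>\<^bsub>group_ring G R A\<^esub> \<in> nilpotents (group_ring G R A)"
proof -
  \<comment> \<open>Exponent one is chosen because the zeroth power is the unity.\<close>
  have "\<zero>\<^bsub>group_ring G R A\<^esub> [^]\<^bsub>group_ring G R A\<^esub> Suc 0 = \<zero>\<^bsub>group_ring G R A\<^esub>"
    by (simp add: nat_pow_def group_ring_mult_zero)
  then show ?thesis using group_ring_zero_closed unfolding nilpotents_def by blast
qed

text \<open>The summands of a homogeneous element provided by NR-cleanness may have other degrees, but
  then they cancel or vanish and can be replaced by zero; likewise for the inner inverse.\<close>

lemma graded_NR_clean_group_ringE:
  assumes clean: "graded_NR_clean G (group_ring G R A) (group_ring_component G R A)"
    and g: "g \<in> carrier G" and x: "x \<in> group_ring_component G R A g"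
  obtains r a n where "r \<in> group_ring_component G R A g" "n \<in> group_ring_component G R A g"
    "a \<in> group_ring_component G R A (inv\<^bsub>G\<^esub> g)"
    "r = r \<otimes>\<^bsub>group_ring G R A\<^esub> a \<otimes>\<^bsub>group_ring G R A\<^esub> r"
    "n \<in> nilpotents (group_ring G R A)" "x = r \<oplus>\<^bsub>group_ring G R A\<^esub> n"
proof -
  let ?S = "group_ring G R A" and ?C = "group_ring_component G R A"
  have zero: "\<zero>\<^bsub>?S\<^esub> = \<zero>\<^bsub>?S\<^esub> \<otimes>\<^bsub>?S\<^esub> \<zero>\<^bsub>?S\<^esub> \<otimes>\<^bsub>?S\<^esub> \<zero>\<^bsub>?S\<^esub>"
    by (simp add: group_ring_mult_zero)
  note zero_comp = group_ring_zero_component[OF g]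
  have "x \<in> homogeneous G ?C" using g x by (auto simp: homogeneous_def)
  then obtain r n where "r \<in> graded_regular G ?S ?C" "n \<in> nilpotents ?S \<inter> homogeneous G ?C"
    and xrn: "x = r \<oplus>\<^bsub>?S\<^esub> n"
    using clean unfolding graded_NR_clean_def by blast
  then obtain g1 g2 a h where r: "g1 \<in> carrier G" "r \<in> ?C g1" and n: "g2 \<in> carrier G" "n \<in> ?C g2"
    and a: "h \<in> carrier G" "a \<in> ?C h" and rar: "r = r \<otimes>\<^bsub>?S\<^esub> a \<otimes>\<^bsub>?S\<^esub> r" and nil: "n \<in> nilpotents ?S"
    by (auto simp: graded_regular_def homogeneous_def)
  have "\<exists>r n a h. r \<in> ?C g \<and> n \<in> ?C g \<and> h \<in> carrier G \<and> a \<in> ?C h \<and>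
      r = r \<otimes>\<^bsub>?S\<^esub> a \<otimes>\<^bsub>?S\<^esub> r \<and> n \<in> nilpotents ?S \<and> x = r \<oplus>\<^bsub>?S\<^esub> n"
  proof (cases "g1 = g2")
    case True
    show ?thesis
    proof (cases "g1 = g")
      case True
      then show ?thesis using r n a rar nil xrn \<open>g1 = g2\<close> by blast
    next
      case False
      \<comment> \<open>Both summands share a wrong degree, so \<open>x\<close> has two degrees and
        vanishes: the summands cancel, and a pair of zeros replaces them.\<close>
      have "x \<in> ?C g1"
        using group_ring_add_component[OF r] n True xrn by simp
      then have "x = \<zero>\<^bsub>?S\<^esub>"
        using group_ring_component_inter_trivial[OF r(1) g False] x by blast
      then have "x = \<zero>\<^bsub>?S\<^esub> \<oplus>\<^bsub>?S\<^esub> \<zero>\<^bsub>?S\<^esub>"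
        using group_ring_add_zero[OF group_ring_zero_closed] by simp
      then show ?thesis
        using zero_comp g zero group_ring_zero_nilpotent by blast
    qed
  next
    case False
    \<comment> \<open>With the summands exchanged, \<open>group_ring_summand_zero\<close> applies to
      \<open>n\<close> as well as to \<open>r\<close>. As their degrees differ, each of them has
      degree \<open>g\<close> or is zero, and zero belongs to every component.\<close>
    have nr: "n \<oplus>\<^bsub>?S\<^esub> r \<in> ?C g"
      using x xrn group_ring_add_comm group_ring_componentD(1) r(2) n(2) by metis
    have "r \<in> ?C g"
    proof (cases "g1 = g")
      case ne: False
      have "r = \<zero>\<^bsub>?S\<^esub>"
        using group_ring_summand_zero[OF r(1) n(1) g False ne r(2) n(2)] x xrn by simp
      then show ?thesis using zero_comp by simp
    qed (use r in simp)
    moreover have "n \<in> ?C g"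
    proof (cases "g2 = g")
      case ne: False
      have "n = \<zero>\<^bsub>?S\<^esub>"
        using group_ring_summand_zero[OF n(1) r(1) g not_sym[OF False] ne n(2) r(2) nr] .
      then show ?thesis using zero_comp by simp
    qed (use n in simp)
    ultimately show ?thesis using a rar nil xrn by blast
  qed
  then obtain r n a h where r: "r \<in> ?C g" and n: "n \<in> ?C g" and a: "h \<in> carrier G" "a \<in> ?C h"
    and rar: "r = r \<otimes>\<^bsub>?S\<^esub> a \<otimes>\<^bsub>?S\<^esub> r" and nil: "n \<in> nilpotents ?S" and xrn: "x = r \<oplus>\<^bsub>?S\<^esub> n"
    by blast
  show thesis
  proof (cases "h = inv\<^bsub>G\<^esub> g")
    case True
    then show thesis using that r n a rar nil xrn by blast
  next
    case False
    \<comment> \<open>The equation r = r a r places \<open>r\<close> in degree ghg as well as in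
      degree \<open>g\<close>. If \<open>h\<close> is not the inverse of \<open>g\<close>, these
      degrees differ, so \<open>r\<close> is zero and zero is an inner inverse of it in the required
      degree.\<close>
    have "g \<otimes>\<^bsub>G\<^esub> h \<otimes>\<^bsub>G\<^esub> g \<noteq> g"
    proof
      assume "g \<otimes>\<^bsub>G\<^esub> h \<otimes>\<^bsub>G\<^esub> g = g"
      then have "h \<otimes>\<^bsub>G\<^esub> g = \<one>\<^bsub>G\<^esub>" using g a(1) by (simp add: G.m_assoc)
      then show False using G.inv_equality g a(1) False by blast
    qed
    moreover have "r \<in> ?C (g \<otimes>\<^bsub>G\<^esub> h \<otimes>\<^bsub>G\<^esub> g)"
      using group_ring_component_mult[OF _ g group_ring_component_mult[OF g a(1) r a(2)] r] g a rar
      by simp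
    ultimately have "r = \<zero>\<^bsub>?S\<^esub>"
      using group_ring_component_inter_trivial[OF _ g] r g a by blast
    then show thesis
      using that[OF r n group_ring_zero_component] g zero nil xrn by simp
  qed
qed

end

section \<open>Corners of graded central idempotents\<close>

lemma corner_ring_simps [simp]:
  "x \<otimes>\<^bsub>corner_ring R f\<^esub> y = x \<otimes>\<^bsub>R\<^esub> y" "x \<oplus>\<^bsub>corner_ring R f\<^esub> y = x \<oplus>\<^bsub>R\<^esub> y"
  "\<zero>\<^bsub>corner_ring R f\<^esub> = \<zero>\<^bsub>R\<^esub>" "\<one>\<^bsub>corner_ring R f\<^esub> = f"
  by (simp_all add: corner_ring_def)

text \<open>Asking that \<open>f\<close> preserve the components, rather than that it be homogeneous, makes the
  locale visibly closed under complements, without knowing that \<open>1\<close> has degree \<open>e\<close>.\<close>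

locale graded_central_idempotent = graded_ring +
  fixes f
  assumes f_closed: "f \<in> carrier R"
    and f_idem: "f \<otimes>\<^bsub>R\<^esub> f = f"
    and f_central: "x \<in> carrier R \<Longrightarrow> f \<otimes>\<^bsub>R\<^esub> x = x \<otimes>\<^bsub>R\<^esub> f"
    and f_component: "g \<in> carrier G \<Longrightarrow> x \<in> A g \<Longrightarrow> f \<otimes>\<^bsub>R\<^esub> x \<in> A g"
begin

lemma f_f_mult: "x \<in> carrier R \<Longrightarrow> f \<otimes>\<^bsub>R\<^esub> (f \<otimes>\<^bsub>R\<^esub> x) = f \<otimes>\<^bsub>R\<^esub> x"
  using f_closed f_idem by (simp flip: R.m_assoc)

lemma mem_corner_ring: "x \<in> carrier (corner_ring R f) \<longleftrightarrow> x \<in> carrier R \<and> f \<otimes>\<^bsub>R\<^esub> x = x"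
proof
  assume "x \<in> carrier (corner_ring R f)"
  then show "x \<in> carrier R \<and> f \<otimes>\<^bsub>R\<^esub> x = x"
    using f_f_mult f_closed by (auto simp: corner_ring_def l_coset_def)
next
  assume "x \<in> carrier R \<and> f \<otimes>\<^bsub>R\<^esub> x = x"
  then show "x \<in> carrier (corner_ring R f)" by (force simp: corner_ring_def l_coset_def)
qed

lemma mem_corner_component:
  assumes g: "g \<in> carrier G"
  shows "x \<in> corner_component R f A g \<longleftrightarrow> x \<in> A g \<and> f \<otimes>\<^bsub>R\<^esub> x = x"
proof
  assume "x \<in> corner_component R f A g"
  then show "x \<in> A g \<and> f \<otimes>\<^bsub>R\<^esub> x = x"
    using f_f_mult f_component[OF g] component_in_carrier[OF g]
    by (auto simp: corner_component_def l_coset_def)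
next
  assume "x \<in> A g \<and> f \<otimes>\<^bsub>R\<^esub> x = x"
  then show "x \<in> corner_component R f A g" by (force simp: corner_component_def l_coset_def)
qed

section \<open>The corner as a graded ring\<close>

lemma corner_is_ring: "ring (corner_ring R f)"
proof (rule ringI)
  show "abelian_group (corner_ring R f)"
  proof (rule abelian_groupI)
    fix x assume x: "x \<in> carrier (corner_ring R f)"
    then have "\<ominus>\<^bsub>R\<^esub> x \<in> carrier (corner_ring R f)"
      using f_closed by (simp add: mem_corner_ring R.r_minus)
    moreover have "\<ominus>\<^bsub>R\<^esub> x \<oplus>\<^bsub>corner_ring R f\<^esub> x = \<zero>\<^bsub>corner_ring R f\<^esub>"
      using x by (simp add: mem_corner_ring R.l_neg)
    ultimately show "\<exists>y \<in> carrier (corner_ring R f). y \<oplus>\<^bsub>corner_ring R f\<^esub> x = \<zero>\<^bsub>corner_ring R f\<^esub>" ..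
  qed (use f_closed in \<open>auto simp: mem_corner_ring R.r_distr R.a_assoc intro: R.a_comm\<close>)
  show "Group.monoid (corner_ring R f)"
  proof (rule monoidI)
    fix x y assume "x \<in> carrier (corner_ring R f)" "y \<in> carrier (corner_ring R f)"
    then show "x \<otimes>\<^bsub>corner_ring R f\<^esub> y \<in> carrier (corner_ring R f)"
      using f_closed by (simp add: mem_corner_ring flip: R.m_assoc)
  next
    \<comment> \<open>The left unit law is the fixed-point equation itself; the right one comes from
      centrality.\<close>
    fix x assume "x \<in> carrier (corner_ring R f)"
    then show "x \<otimes>\<^bsub>corner_ring R f\<^esub> \<one>\<^bsub>corner_ring R f\<^esub> = x"
      using f_central[of x] by (simp add: mem_corner_ring)
  qed (use f_closed f_idem in \<open>auto simp: mem_corner_ring R.m_assoc\<close>)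
qed (auto simp: mem_corner_ring R.l_distr R.r_distr)

text \<open>The carrier enters the definition of a finite sum, so the two sums are different terms.
  They agree by induction because addition and zero are shared.\<close>

lemma corner_finsum:
  assumes "u \<in> S \<rightarrow> carrier (corner_ring R f)"
  shows "finsum (corner_ring R f) u S = finsum R u S"
proof -
  interpret C: ring "corner_ring R f" by (rule corner_is_ring)
  show ?thesis using assms
  proof (induction S rule: infinite_finite_induct)
    case (insert i S)
    then have "u \<in> S \<rightarrow> carrier R" "u i \<in> carrier R" by (auto simp: mem_corner_ring)
    with insert show ?case by (simp add: R.finsum_insert C.finsum_insert)
  qed (simp_all add: R.finsum_infinite C.finsum_infinite)
qed

text \<open>One direction holds because the components of the corner lie in those of the ring. For
  the other, the parts of \<open>x\<close> must be shown to lie in the corner, which follows by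
  multiplying by \<open>f\<close> and using uniqueness in \<open>R\<close>.\<close>

lemma corner_is_decomposition:
  assumes x: "x \<in> carrier (corner_ring R f)"
  shows "is_decomposition G (corner_ring R f) (corner_component R f A) x u \<longleftrightarrow>
    is_decomposition G R A x u"
proof
  assume d: "is_decomposition G (corner_ring R f) (corner_component R f A) x u"
  then have u: "u \<in> (\<Pi>\<^sub>E g \<in> carrier G. corner_component R f A g)"
    by (simp add: is_decomposition_def)
  then have "u \<in> carrier G \<rightarrow> carrier (corner_ring R f)"
    using component_in_carrier by (auto simp: mem_corner_ring mem_corner_component PiE_iff)
  then have "finsum (corner_ring R f) u {g \<in> carrier G. u g \<noteq> \<zero>\<^bsub>R\<^esub>} =
      finsum R u {g \<in> carrier G. u g \<noteq> \<zero>\<^bsub>R\<^esub>}"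
    by (intro corner_finsum) auto
  with d u show "is_decomposition G R A x u"
    by (auto simp: is_decomposition_def PiE_iff mem_corner_component)
next
  assume d: "is_decomposition G R A x u"
  then have u: "u \<in> (\<Pi>\<^sub>E g \<in> carrier G. A g)" and xu: "x = finsum R u {g \<in> carrier G. u g \<noteq> \<zero>\<^bsub>R\<^esub>}"
    and fin: "finite {g \<in> carrier G. u g \<noteq> \<zero>\<^bsub>R\<^esub>}"
    by (simp_all add: is_decomposition_def)
  let ?S = "{g \<in> carrier G. u g \<noteq> \<zero>\<^bsub>R\<^esub>}" and ?v = "\<lambda>g \<in> carrier G. f \<otimes>\<^bsub>R\<^esub> u g"
  have uR: "u \<in> carrier G \<rightarrow> carrier R" using u component_in_carrier by blast
  have xR: "x \<in> carrier R" "f \<otimes>\<^bsub>R\<^esub> x = x" using x by (auto simp: mem_corner_ring)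
  have "x = f \<otimes>\<^bsub>R\<^esub> finsum R u ?S" using xR xu by simp
  also have "\<dots> = finsum R (\<lambda>g. f \<otimes>\<^bsub>R\<^esub> u g) ?S"
    by (rule R.finsum_rdistr) (use fin f_closed uR in auto)
  also have "\<dots> = finsum R ?v ?S"
    by (rule R.finsum_cong') (use f_closed uR in \<open>auto simp: Pi_iff\<close>)
  finally have "is_decomposition G R A x ?v"
    by (intro is_decompositionI[OF _ fin]) (use u f_component f_closed in auto)
  \<comment> \<open>Both families decompose \<open>x\<close>, the second because \<open>f\<close>
    fixes \<open>x\<close> and preserves components.\<close>
  then have "u = ?v" using d direct_sum[OF xR(1)] by blast
  then have fu: "f \<otimes>\<^bsub>R\<^esub> u g = u g" if "g \<in> carrier G" for g
    using that by (metis restrict_apply')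
  have "finsum (corner_ring R f) u ?S = finsum R u ?S"
    by (rule corner_finsum) (use uR fu in \<open>auto simp: mem_corner_ring\<close>)
  then show "is_decomposition G (corner_ring R f) (corner_component R f A) x u"
    using u fu xu fin by (auto simp: is_decomposition_def PiE_iff mem_corner_component)
qed

text \<open>Makes the results on group rings available over the corner; in particular, the
  normalisation of degrees in a clean decomposition is applied there. Directness of the sum is
  inherited from \<open>R\<close> through \<open>corner_is_decomposition\<close>.\<close>

sublocale corner: graded_ring G "corner_ring R f" "corner_component R f A"
proof -
  interpret C: ring "corner_ring R f" by (rule corner_is_ring)
  show "graded_ring G (corner_ring R f) (corner_component R f A)"
  proof (intro graded_ring.intro[OF G.group_axioms corner_is_ring] graded_ring_axioms.intro)
    fix g assume g: "g \<in> carrier G"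
    \<comment> \<open>The additive inverse is taken in another ring record; it agrees with the one
      of \<open>R\<close> by uniqueness of inverses.\<close>
    have minus: "\<ominus>\<^bsub>corner_ring R f\<^esub> x = \<ominus>\<^bsub>R\<^esub> x" if "x \<in> carrier (corner_ring R f)" for x
      by (rule C.minus_equality)
        (use that f_closed in \<open>auto simp: mem_corner_ring R.r_minus R.l_neg\<close>)
    have inv: "\<ominus>\<^bsub>corner_ring R f\<^esub> x \<in> corner_component R f A g"
      if "x \<in> corner_component R f A g" for x
      using that minus[of x] g f_closed component_minus component_in_carrier
      by (auto simp: mem_corner_component mem_corner_ring R.r_minus)
    show "additive_subgroup (corner_component R f A g) (corner_ring R f)"
    proof (intro additive_subgroupI group.subgroupI[OF C.a_group])
      show "corner_component R f A g \<noteq> {}"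
        using mem_corner_component[OF g, of "\<zero>\<^bsub>R\<^esub>"] component_zero[OF g] f_closed by auto
    next
      show "corner_component R f A g \<subseteq> carrier (add_monoid (corner_ring R f))"
        using g component_in_carrier by (auto simp: mem_corner_ring mem_corner_component)
    next
      fix x y assume "x \<in> corner_component R f A g" "y \<in> corner_component R f A g"
      then show "x \<otimes>\<^bsub>add_monoid (corner_ring R f)\<^esub> y \<in> corner_component R f A g"
        using component_add[OF g] component_in_carrier[OF g] f_closed
        by (simp add: mem_corner_component[OF g] R.r_distr)
    qed (rule inv[unfolded a_inv_def])
  next
    fix g h x y
    assume g: "g \<in> carrier G" and h: "h \<in> carrier G"
      and "x \<in> corner_component R f A g" "y \<in> corner_component R f A h"
    then have x: "x \<in> A g" "f \<otimes>\<^bsub>R\<^esub> x = x" and y: "y \<in> A h"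
      by (auto simp: mem_corner_component)
    have R: "x \<in> carrier R" "y \<in> carrier R" using x y g h component_in_carrier by auto
    have "f \<otimes>\<^bsub>R\<^esub> (x \<otimes>\<^bsub>R\<^esub> y) = x \<otimes>\<^bsub>R\<^esub> y"
      using R x f_closed by (simp flip: R.m_assoc)
    then show "x \<otimes>\<^bsub>corner_ring R f\<^esub> y \<in> corner_component R f A (g \<otimes>\<^bsub>G\<^esub> h)"
      using x y g h component_mult by (simp add: mem_corner_component)
  next
    fix x assume x: "x \<in> carrier (corner_ring R f)"
    then show "\<exists>!u. is_decomposition G (corner_ring R f) (corner_component R f A) x u"
      using direct_sum[of x] by (simp add: corner_is_decomposition[OF x] mem_corner_ring)
  qed
qed

section \<open>Group rings over a corner\<close>

lemma corner_component_of:
  "x \<in> carrier (corner_ring R f) \<Longrightarrow>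
    component_of G (corner_ring R f) (corner_component R f A) g x = component_of G R A g x"
  by (simp add: component_of_def corner_is_decomposition)

text \<open>Since the zeros coincide, so do the supports, and the inclusion into the group ring of
  \<open>R\<close> is the identity on functions.\<close>

lemma corner_group_ring_carrier:
  "p \<in> carrier (group_ring G (corner_ring R f) (corner_component R f A)) \<longleftrightarrow>
    p \<in> carrier (group_ring G R A) \<and> (\<forall>k \<in> carrier G. f \<otimes>\<^bsub>R\<^esub> p k = p k)"
  by (auto simp: group_ring_carrier PiE_iff mem_corner_ring)

lemma corner_group_ring_component:
  assumes "g \<in> carrier G"
  shows "p \<in> group_ring_component G (corner_ring R f) (corner_component R f A) g \<longleftrightarrow>
    p \<in> group_ring_component G R A g \<and> (\<forall>k \<in> carrier G. f \<otimes>\<^bsub>R\<^esub> p k = p k)"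
  using assms by (auto simp: group_ring_component_def corner_group_ring_carrier mem_corner_component)

lemma corner_group_ring_zero:
  "\<zero>\<^bsub>group_ring G (corner_ring R f) (corner_component R f A)\<^esub> = \<zero>\<^bsub>group_ring G R A\<^esub>"
  by (simp add: group_ring_zero)

text \<open>Homogeneous parts of coefficients are the same in both rings, so index sets and summands
  agree; \<open>corner_finsum\<close> then moves the sum from the corner to
  \<open>R\<close>.\<close>

lemma corner_group_ring_mult:
  assumes p: "p \<in> carrier (group_ring G (corner_ring R f) (corner_component R f A))"
    and q: "q \<in> carrier (group_ring G (corner_ring R f) (corner_component R f A))"
  shows "p \<otimes>\<^bsub>group_ring G (corner_ring R f) (corner_component R f A)\<^esub> q = p \<otimes>\<^bsub>group_ring G R A\<^esub> q"
proof -
  have cl: "p \<in> carrier G \<rightarrow> carrier (corner_ring R f)" "q \<in> carrier G \<rightarrow> carrier (corner_ring R f)"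
    using p q by (auto simp: group_ring_carrier)
  have supp: "convolution_support G (corner_ring R f) (corner_component R f A) p q m =
      convolution_support G R A p q m" for m
    using cl by (auto simp: convolution_support_def corner_component_of Pi_iff)
  have "finsum (corner_ring R f) (convolution_summand G (corner_ring R f) (corner_component R f A) p q)
      (convolution_support G R A p q m) =
    finsum R (convolution_summand G R A p q) (convolution_support G R A p q m)" for m
  proof -
    have in_corner: "convolution_summand G (corner_ring R f) (corner_component R f A) p q
        \<in> convolution_support G R A p q m \<rightarrow> carrier (corner_ring R f)"
      using corner.convolution_summand_closed[OF cl] by (auto simp: convolution_support_def)
    have "finsum (corner_ring R f) (convolution_summand G (corner_ring R f) (corner_component R f A) p q)
        (convolution_support G R A p q m) =
      finsum R (convolution_summand G (corner_ring R f) (corner_component R f A) p q)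
        (convolution_support G R A p q m)"
      by (rule corner_finsum[OF in_corner])
    also have "\<dots> = finsum R (convolution_summand G R A p q) (convolution_support G R A p q m)"
    proof (rule R.finsum_cong'[OF refl])
      show "convolution_summand G R A p q \<in> convolution_support G R A p q m \<rightarrow> carrier R"
        using cl convolution_summand_closed[of p q]
        by (auto simp: convolution_support_def mem_corner_ring Pi_iff)
    next
      fix i assume "i \<in> convolution_support G R A p q m"
      then show "convolution_summand G (corner_ring R f) (corner_component R f A) p q i =
          convolution_summand G R A p q i"
        using cl by (auto simp: convolution_support_def convolution_summand_def corner_component_of Pi_iff)
    qed
    finally show ?thesis .
  qed
  then show ?thesis by (simp add: group_ring_mult supp)
qed

lemma complement: "graded_central_idempotent G R A (\<one>\<^bsub>R\<^esub> \<ominus>\<^bsub>R\<^esub> f)"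
proof
  show "\<one>\<^bsub>R\<^esub> \<ominus>\<^bsub>R\<^esub> f \<in> carrier R" using f_closed by simp
  \<comment> \<open>Multiplication by the complement subtracts fx from x. Idempotence, centrality
    and preservation of components are all read off from this.\<close>
  have l: "(\<one>\<^bsub>R\<^esub> \<ominus>\<^bsub>R\<^esub> f) \<otimes>\<^bsub>R\<^esub> x = x \<ominus>\<^bsub>R\<^esub> f \<otimes>\<^bsub>R\<^esub> x" if "x \<in> carrier R" for x
    using that f_closed by (simp add: R.minus_eq R.l_distr R.l_minus)
  show "(\<one>\<^bsub>R\<^esub> \<ominus>\<^bsub>R\<^esub> f) \<otimes>\<^bsub>R\<^esub> (\<one>\<^bsub>R\<^esub> \<ominus>\<^bsub>R\<^esub> f) = \<one>\<^bsub>R\<^esub> \<ominus>\<^bsub>R\<^esub> f"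
  proof -
    have "f \<otimes>\<^bsub>R\<^esub> (\<one>\<^bsub>R\<^esub> \<ominus>\<^bsub>R\<^esub> f) = \<zero>\<^bsub>R\<^esub>"
      using f_closed f_idem by (simp add: R.minus_eq R.r_distr R.r_minus R.r_neg)
    then show ?thesis using l[of "\<one>\<^bsub>R\<^esub> \<ominus>\<^bsub>R\<^esub> f"] f_closed by (simp add: R.minus_eq)
  qed
  show "(\<one>\<^bsub>R\<^esub> \<ominus>\<^bsub>R\<^esub> f) \<otimes>\<^bsub>R\<^esub> x = x \<otimes>\<^bsub>R\<^esub> (\<one>\<^bsub>R\<^esub> \<ominus>\<^bsub>R\<^esub> f)" if "x \<in> carrier R" for x
    using that f_closed f_central[OF that] l[OF that]
    by (simp add: R.minus_eq R.r_distr R.r_minus)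
  show "(\<one>\<^bsub>R\<^esub> \<ominus>\<^bsub>R\<^esub> f) \<otimes>\<^bsub>R\<^esub> x \<in> A g" if "g \<in> carrier G" "x \<in> A g" for g x
    using l[of x] that component_in_carrier[of g x] f_component component_add component_minus
    by (simp add: R.minus_eq)
qed

end

section \<open>The product decomposition of the group ring\<close>

text \<open>A second idempotent \<open>f'\<close> stands for 1 - f, which makes the situation
  symmetric: each one-sided fact can be reused with the roles exchanged, through
  \<open>swap\<close>.\<close>

locale orthogonal_central_idempotents =
  I: graded_central_idempotent G R A f + J: graded_central_idempotent G R A f'
  for G (structure) and R (structure) and A f f' +
  assumes f_f': "f \<otimes>\<^bsub>R\<^esub> f' = \<zero>\<^bsub>R\<^esub>" and f_add_f': "f \<oplus>\<^bsub>R\<^esub> f' = \<one>\<^bsub>R\<^esub>"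
begin

abbreviation "S \<equiv> group_ring G R A"
abbreviation "S1 \<equiv> group_ring G (corner_ring R f) (corner_component R f A)"
abbreviation "S2 \<equiv> group_ring G (corner_ring R f') (corner_component R f' A)"

lemma f'_f: "f' \<otimes>\<^bsub>R\<^esub> f = \<zero>\<^bsub>R\<^esub>"
  using I.f_central[OF J.f_closed, symmetric] f_f' by (rule trans)

text \<open>By centrality \<open>x\<close> is also fixed by \<open>f\<close> from the right, so xy =
  (xf)(f'y) = x(ff')y.\<close>

lemma orthogonal_mult:
  assumes "x \<in> carrier R" "y \<in> carrier R" "f \<otimes>\<^bsub>R\<^esub> x = x" "f' \<otimes>\<^bsub>R\<^esub> y = y"
  shows "x \<otimes>\<^bsub>R\<^esub> y = \<zero>\<^bsub>R\<^esub>"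
proof -
  have "x \<otimes>\<^bsub>R\<^esub> f = x" by (metis I.f_central assms(1,3))
  then have "x \<otimes>\<^bsub>R\<^esub> y = (x \<otimes>\<^bsub>R\<^esub> f) \<otimes>\<^bsub>R\<^esub> (f' \<otimes>\<^bsub>R\<^esub> y)"
    using assms(4) by simp
  also have "\<dots> = x \<otimes>\<^bsub>R\<^esub> (f \<otimes>\<^bsub>R\<^esub> f') \<otimes>\<^bsub>R\<^esub> y"
    using assms(1,2) I.f_closed J.f_closed by (simp add: I.R.m_assoc)
  also have "\<dots> = \<zero>\<^bsub>R\<^esub>" using assms f_f' by simp
  finally show ?thesis .
qed

lemma swap: "orthogonal_central_idempotents G R A f' f"
  by unfold_locales
    (use f'_f f_add_f' I.f_closed J.f_closed in \<open>auto simp: I.R.a_comm\<close>)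

text \<open>Corners contain the homogeneous parts of their elements, so every summand of the
  convolution is a product across the two corners and vanishes.\<close>

lemma group_ring_orthogonal_mult:
  assumes p: "p \<in> carrier S1" and q: "q \<in> carrier S2"
  shows "p \<otimes>\<^bsub>S\<^esub> q = \<zero>\<^bsub>S\<^esub>"
proof -
  have pq: "p k \<in> carrier (corner_ring R f)" "q k \<in> carrier (corner_ring R f')"
    if "k \<in> carrier G" for k
    using p q that by (auto simp: group_ring_carrier PiE_iff)
  have "finsum R (convolution_summand G R A p q) (convolution_support G R A p q m) = \<zero>\<^bsub>R\<^esub>" for m
  proof (rule I.R.add.finprod_one_eqI)
    fix i assume "i \<in> convolution_support G R A p q m"
    then obtain g k h l where i: "i = (g, k, h, l)"
      and c: "g \<in> carrier G" "k \<in> carrier G" "h \<in> carrier G" "l \<in> carrier G"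
      by (auto simp: convolution_support_def)
    have "component_of G R A g (p k) \<in> carrier (corner_ring R f)"
      using I.corner.component_of_closed[OF pq(1)[OF c(2)] c(1)] pq(1) c
      by (simp add: I.corner_component_of)
    moreover have "component_of G R A h (q l) \<in> carrier (corner_ring R f')"
      using J.corner.component_of_closed[OF pq(2)[OF c(4)] c(3)] pq(2) c
      by (simp add: J.corner_component_of)
    ultimately show "convolution_summand G R A p q i = \<zero>\<^bsub>R\<^esub>"
      by (simp add: i convolution_summand_def orthogonal_mult I.mem_corner_ring J.mem_corner_ring)
  qed
  then show ?thesis by (simp add: group_ring_mult group_ring_zero)
qed

text \<open>This is the product decomposition in usable form: after expanding, the two cross terms
  vanish by orthogonality, the second of them with the idempotents exchanged.\<close>

lemma group_ring_mult_sum: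
  assumes p: "p \<in> carrier S1" and p': "p' \<in> carrier S2"
    and q: "q \<in> carrier S1" and q': "q' \<in> carrier S2"
  shows "(p \<oplus>\<^bsub>S\<^esub> p') \<otimes>\<^bsub>S\<^esub> (q \<oplus>\<^bsub>S\<^esub> q') = (p \<otimes>\<^bsub>S1\<^esub> q) \<oplus>\<^bsub>S\<^esub> (p' \<otimes>\<^bsub>S2\<^esub> q')"
proof -
  interpret swapped: orthogonal_central_idempotents G R A f' f by (rule swap)
  have c: "p \<in> carrier S" "p' \<in> carrier S" "q \<in> carrier S" "q' \<in> carrier S"
    using assms I.corner_group_ring_carrier J.corner_group_ring_carrier by auto
  have "(p \<oplus>\<^bsub>S\<^esub> p') \<otimes>\<^bsub>S\<^esub> (q \<oplus>\<^bsub>S\<^esub> q') =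
      (p \<otimes>\<^bsub>S\<^esub> q \<oplus>\<^bsub>S\<^esub> p' \<otimes>\<^bsub>S\<^esub> q) \<oplus>\<^bsub>S\<^esub> (p \<otimes>\<^bsub>S\<^esub> q' \<oplus>\<^bsub>S\<^esub> p' \<otimes>\<^bsub>S\<^esub> q')"
    using c by (simp add: I.group_ring_l_distr I.group_ring_r_distr I.group_ring_add_closed)
  then show ?thesis
    using group_ring_orthogonal_mult[OF p q'] swapped.group_ring_orthogonal_mult[OF p' q] c
      I.group_ring_mult_closed
    by (simp add: I.group_ring_add_zero I.corner_group_ring_mult[OF p q] J.corner_group_ring_mult[OF p' q'])
qed

lemma group_ring_one_sum: "\<one>\<^bsub>S\<^esub> = \<one>\<^bsub>S1\<^esub> \<oplus>\<^bsub>S\<^esub> \<one>\<^bsub>S2\<^esub>"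
  using f_add_f' by (auto simp: group_ring_one group_ring_add)

lemma group_ring_pow_sum:
  fixes n :: nat
  assumes p: "p \<in> carrier S1" and q: "q \<in> carrier S2"
  shows "(p \<oplus>\<^bsub>S\<^esub> q) [^]\<^bsub>S\<^esub> n = (p [^]\<^bsub>S1\<^esub> n) \<oplus>\<^bsub>S\<^esub> (q [^]\<^bsub>S2\<^esub> n)"
proof (induction n)
  case 0
  \<comment> \<open>At exponent zero the three powers are three different unities, which is where f
    + f' = 1 enters.\<close>
  then show ?case by (simp add: nat_pow_def group_ring_one_sum)
next
  case (Suc n)
  have "(p \<oplus>\<^bsub>S\<^esub> q) [^]\<^bsub>S\<^esub> Suc n = ((p [^]\<^bsub>S1\<^esub> n) \<oplus>\<^bsub>S\<^esub> (q [^]\<^bsub>S2\<^esub> n)) \<otimes>\<^bsub>S\<^esub> (p \<oplus>\<^bsub>S\<^esub> q)"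
    using Suc by (simp add: nat_pow_def)
  also have "\<dots> = (p [^]\<^bsub>S1\<^esub> n \<otimes>\<^bsub>S1\<^esub> p) \<oplus>\<^bsub>S\<^esub> (q [^]\<^bsub>S2\<^esub> n \<otimes>\<^bsub>S2\<^esub> q)"
    by (intro group_ring_mult_sum p q I.corner.group_ring_pow_closed J.corner.group_ring_pow_closed)
  finally show ?case by (simp add: nat_pow_def)
qed

lemma group_ring_nilpotent_sum:
  assumes p: "p \<in> nilpotents S1" and q: "q \<in> nilpotents S2"
  shows "p \<oplus>\<^bsub>S\<^esub> q \<in> nilpotents S"
proof -
  obtain i j :: nat where i: "p \<in> carrier S1" "p [^]\<^bsub>S1\<^esub> i = \<zero>\<^bsub>S1\<^esub>"
    and j: "q \<in> carrier S2" "q [^]\<^bsub>S2\<^esub> j = \<zero>\<^bsub>S2\<^esub>"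
    using p q by (auto simp: nilpotents_def)
  \<comment> \<open>The sum of the two exponents annihilates both factors at once.\<close>
  have "(p \<oplus>\<^bsub>S\<^esub> q) [^]\<^bsub>S\<^esub> (i + j) = \<zero>\<^bsub>S\<^esub> \<oplus>\<^bsub>S\<^esub> \<zero>\<^bsub>S\<^esub>"
    using group_ring_pow_sum[OF i(1) j(1)] I.corner.group_ring_nilpotent_add[OF i, of j]
      J.corner.group_ring_nilpotent_add[OF j, of i]
    by (simp add: add.commute[of j i] I.corner_group_ring_zero J.corner_group_ring_zero)
  moreover have "p \<oplus>\<^bsub>S\<^esub> q \<in> carrier S"
    using i j I.corner_group_ring_carrier J.corner_group_ring_carrier I.group_ring_add_closed by blast
  ultimately show ?thesis
    using I.group_ring_add_zero[OF I.group_ring_zero_closed] by (auto simp: nilpotents_def)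
qed

lemma graded_NR_clean_group_ring_sum:
  assumes clean1: "graded_NR_clean G S1
      (group_ring_component G (corner_ring R f) (corner_component R f A))"
    and clean2: "graded_NR_clean G S2
      (group_ring_component G (corner_ring R f') (corner_component R f' A))"
  shows "graded_NR_clean G S (group_ring_component G R A)"
  unfolding graded_NR_clean_def
proof
  let ?C = "group_ring_component G R A"
  let ?C1 = "group_ring_component G (corner_ring R f) (corner_component R f A)"
  let ?C2 = "group_ring_component G (corner_ring R f') (corner_component R f' A)"
  fix x assume "x \<in> homogeneous G ?C"
  then obtain g where g: "g \<in> carrier G" and x: "x \<in> ?C g" by (auto simp: homogeneous_def)
  have xR: "x k \<in> carrier R" if "k \<in> carrier G" for k
    using group_ring_componentD(1)[OF x] that by (auto simp: group_ring_carrier)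
  \<comment> \<open>Projection to a corner acts on coefficients. It can only shrink the support, and
    it keeps the degree because \<open>e\<close> preserves components; stated for any
    \<open>e\<close>, it serves both corners.\<close>
  have cut: "(\<lambda>k \<in> carrier G. e \<otimes>\<^bsub>R\<^esub> x k) \<in> group_ring_component G (corner_ring R e) (corner_component R e A) g"
    if "graded_central_idempotent G R A e" for e
  proof -
    interpret E: graded_central_idempotent G R A e by (rule that)
    have "finite {k \<in> carrier G. e \<otimes>\<^bsub>R\<^esub> x k \<noteq> \<zero>\<^bsub>R\<^esub>}"
    proof (rule finite_subset)
      show "{k \<in> carrier G. e \<otimes>\<^bsub>R\<^esub> x k \<noteq> \<zero>\<^bsub>R\<^esub>} \<subseteq> {k \<in> carrier G. x k \<noteq> \<zero>\<^bsub>R\<^esub>}"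
        using E.f_closed by auto
    qed (use group_ring_componentD(1)[OF x] in \<open>simp add: group_ring_carrier\<close>)
    then have "(\<lambda>k \<in> carrier G. e \<otimes>\<^bsub>R\<^esub> x k) \<in> ?C g"
      using xR E.f_closed E.f_component group_ring_componentD(2)[OF x] g
      by (auto simp: group_ring_component_def group_ring_carrier cong: conj_cong)
    then show ?thesis
      using xR g E.f_f_mult by (simp add: E.corner_group_ring_component)
  qed
  let ?x1 = "\<lambda>k \<in> carrier G. f \<otimes>\<^bsub>R\<^esub> x k" and ?x2 = "\<lambda>k \<in> carrier G. f' \<otimes>\<^bsub>R\<^esub> x k"
  obtain r1 a1 n1 where 1: "r1 \<in> ?C1 g" "n1 \<in> ?C1 g" "a1 \<in> ?C1 (inv\<^bsub>G\<^esub> g)"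
    "r1 = r1 \<otimes>\<^bsub>S1\<^esub> a1 \<otimes>\<^bsub>S1\<^esub> r1" "n1 \<in> nilpotents S1" "?x1 = r1 \<oplus>\<^bsub>S1\<^esub> n1"
    using I.corner.graded_NR_clean_group_ringE[OF clean1 g cut[OF I.graded_central_idempotent_axioms]] .
  obtain r2 a2 n2 where 2: "r2 \<in> ?C2 g" "n2 \<in> ?C2 g" "a2 \<in> ?C2 (inv\<^bsub>G\<^esub> g)"
    "r2 = r2 \<otimes>\<^bsub>S2\<^esub> a2 \<otimes>\<^bsub>S2\<^esub> r2" "n2 \<in> nilpotents S2" "?x2 = r2 \<oplus>\<^bsub>S2\<^esub> n2"
    using J.corner.graded_NR_clean_group_ringE[OF clean2 g cut[OF J.graded_central_idempotent_axioms]] .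
  note c1 = group_ring_componentD(1)[OF 1(1)] group_ring_componentD(1)[OF 1(2)]
    group_ring_componentD(1)[OF 1(3)]
  note c2 = group_ring_componentD(1)[OF 2(1)] group_ring_componentD(1)[OF 2(2)]
    group_ring_componentD(1)[OF 2(3)]
  have c: "r1 \<in> ?C g" "n1 \<in> ?C g" "a1 \<in> ?C (inv\<^bsub>G\<^esub> g)" "r2 \<in> ?C g" "n2 \<in> ?C g" "a2 \<in> ?C (inv\<^bsub>G\<^esub> g)"
    using 1 2 g by (auto simp: I.corner_group_ring_component J.corner_group_ring_component)
  note cS = c(1,2,4,5)[THEN group_ring_componentD(1)]
  let ?r = "r1 \<oplus>\<^bsub>S\<^esub> r2" and ?n = "n1 \<oplus>\<^bsub>S\<^esub> n2" and ?a = "a1 \<oplus>\<^bsub>S\<^esub> a2"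
  have "?r \<otimes>\<^bsub>S\<^esub> ?a \<otimes>\<^bsub>S\<^esub> ?r = (r1 \<otimes>\<^bsub>S1\<^esub> a1 \<oplus>\<^bsub>S\<^esub> r2 \<otimes>\<^bsub>S2\<^esub> a2) \<otimes>\<^bsub>S\<^esub> ?r"
    using group_ring_mult_sum[OF c1(1) c2(1) c1(3) c2(3)] by simp
  also have "\<dots> = (r1 \<otimes>\<^bsub>S1\<^esub> a1 \<otimes>\<^bsub>S1\<^esub> r1) \<oplus>\<^bsub>S\<^esub> (r2 \<otimes>\<^bsub>S2\<^esub> a2 \<otimes>\<^bsub>S2\<^esub> r2)"
    by (intro group_ring_mult_sum I.corner.group_ring_mult_closed J.corner.group_ring_mult_closed c1 c2)
  also have "\<dots> = ?r" using 1(4) 2(4) by simp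
  finally have rar: "?r = ?r \<otimes>\<^bsub>S\<^esub> ?a \<otimes>\<^bsub>S\<^esub> ?r" ..
  \<comment> \<open>The normalised degrees pay off here: the two parts of each sum lie in one and
    the same component.\<close>
  have "?r \<in> ?C g" "?n \<in> ?C g" "?a \<in> ?C (inv\<^bsub>G\<^esub> g)"
    by (intro I.group_ring_add_component c g I.G.inv_closed)+
  then have hom: "?r \<in> homogeneous G ?C" "?n \<in> homogeneous G ?C" "?a \<in> homogeneous G ?C"
    using g I.G.inv_closed[OF g] unfolding homogeneous_def by blast+
  have x_eq: "x = ?r \<oplus>\<^bsub>S\<^esub> ?n"
  proof (rule group_ring_eqI)
    show "x \<in> carrier S" by (rule group_ring_componentD(1)[OF x])
    show "?r \<oplus>\<^bsub>S\<^esub> ?n \<in> carrier S"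
      by (intro I.group_ring_add_closed cS)
    fix k assume k: "k \<in> carrier G"
    have m: "r1 k \<in> carrier R" "n1 k \<in> carrier R" "r2 k \<in> carrier R" "n2 k \<in> carrier R"
      using cS k by (auto simp: group_ring_carrier)
    have "x k = (f \<oplus>\<^bsub>R\<^esub> f') \<otimes>\<^bsub>R\<^esub> x k" using xR[OF k] by (simp add: f_add_f')
    also have "\<dots> = f \<otimes>\<^bsub>R\<^esub> x k \<oplus>\<^bsub>R\<^esub> f' \<otimes>\<^bsub>R\<^esub> x k"
      using xR[OF k] I.f_closed J.f_closed by (simp add: I.R.l_distr)
    also have "f \<otimes>\<^bsub>R\<^esub> x k = r1 k \<oplus>\<^bsub>R\<^esub> n1 k"
      using fun_cong[OF 1(6), of k] k by (simp add: group_ring_add)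
    also have "f' \<otimes>\<^bsub>R\<^esub> x k = r2 k \<oplus>\<^bsub>R\<^esub> n2 k"
      using fun_cong[OF 2(6), of k] k by (simp add: group_ring_add)
    also have "(r1 k \<oplus>\<^bsub>R\<^esub> n1 k) \<oplus>\<^bsub>R\<^esub> (r2 k \<oplus>\<^bsub>R\<^esub> n2 k) = (?r \<oplus>\<^bsub>S\<^esub> ?n) k"
      using m k by (simp add: group_ring_add I.R.a_ac)
    finally show "x k = (?r \<oplus>\<^bsub>S\<^esub> ?n) k" .
  qed
  show "\<exists>r \<in> graded_regular G S ?C. \<exists>n \<in> nilpotents S \<inter> homogeneous G ?C. x = r \<oplus>\<^bsub>S\<^esub> n"
    using hom rar x_eq group_ring_nilpotent_sum[OF 1(5) 2(5)] unfolding graded_regular_def by blast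
qed

end

text \<open>If \<open>f\<close> has degree \<open>e\<close>, its square has degree ee. Idempotence
  then leaves two cases: \<open>e\<close> is the identity of the group, or \<open>f\<close> is zero.
  In either case multiplication by \<open>f\<close> keeps degrees.\<close>

lemma (in graded_ring) homogeneous_idempotent_component:
  assumes f: "f \<in> homogeneous G A" and idem: "f \<otimes>\<^bsub>R\<^esub> f = f"
    and g: "g \<in> carrier G" and x: "x \<in> A g"
  shows "f \<otimes>\<^bsub>R\<^esub> x \<in> A g"
proof -
  obtain e where e: "e \<in> carrier G" "f \<in> A e" using f by (auto simp: homogeneous_def)
  show ?thesis
  proof (cases "e = \<one>\<^bsub>G\<^esub>")
    case True
    then show ?thesis using component_mult[OF e(1) g e(2) x] g by simp
  next
    case False
    then have "e \<otimes>\<^bsub>G\<^esub> e \<noteq> e" using e by simp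
    then have "f = \<zero>\<^bsub>R\<^esub>"
      using component_inter_trivial[of "e \<otimes>\<^bsub>G\<^esub> e" e f]
        component_mult[OF e(1) e(1) e(2) e(2)] idem e by simp
    then show ?thesis using component_zero[OF g] component_in_carrier[OF g x] by simp
  qed
qed

theorem proposition3p1:
  fixes G :: "('g, 'm) monoid_scheme" and R :: "('a, 'n) ring_scheme"
    and A :: "'g \<Rightarrow> 'a set" and f :: 'a
  assumes "graded_ring G R A"
    and "f \<in> homogeneous G A"
    and "f \<otimes>\<^bsub>R\<^esub> f = f"
    and "\<And>x. x \<in> carrier R \<Longrightarrow> f \<otimes>\<^bsub>R\<^esub> x = x \<otimes>\<^bsub>R\<^esub> f"
    and "graded_NR_clean G
      (group_ring G (corner_ring R f) (corner_component R f A))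
      (group_ring_component G (corner_ring R f) (corner_component R f A))"
    and "graded_NR_clean G
      (group_ring G (corner_ring R (\<one>\<^bsub>R\<^esub> \<ominus>\<^bsub>R\<^esub> f)) (corner_component R (\<one>\<^bsub>R\<^esub> \<ominus>\<^bsub>R\<^esub> f) A))
      (group_ring_component G (corner_ring R (\<one>\<^bsub>R\<^esub> \<ominus>\<^bsub>R\<^esub> f)) (corner_component R (\<one>\<^bsub>R\<^esub> \<ominus>\<^bsub>R\<^esub> f) A))"
  shows "graded_NR_clean G (group_ring G R A) (group_ring_component G R A)"
proof -
  interpret graded_ring G R A by (rule assms(1))
  have fR: "f \<in> carrier R"
    using assms(2) component_in_carrier by (auto simp: homogeneous_def)
  interpret F: graded_central_idempotent G R A f
    by (unfold_locales; intro fR assms(3,4) homogeneous_idempotent_component[OF assms(2,3)])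
  interpret F': graded_central_idempotent G R A "\<one>\<^bsub>R\<^esub> \<ominus>\<^bsub>R\<^esub> f" by (rule F.complement)
  interpret orthogonal_central_idempotents G R A f "\<one>\<^bsub>R\<^esub> \<ominus>\<^bsub>R\<^esub> f"
  proof
    show "f \<otimes>\<^bsub>R\<^esub> (\<one>\<^bsub>R\<^esub> \<ominus>\<^bsub>R\<^esub> f) = \<zero>\<^bsub>R\<^esub>"
      using fR assms(3) by (simp add: R.minus_eq R.r_distr R.r_minus R.r_neg)
    show "f \<oplus>\<^bsub>R\<^esub> (\<one>\<^bsub>R\<^esub> \<ominus>\<^bsub>R\<^esub> f) = \<one>\<^bsub>R\<^esub>"
      using fR by (simp add: R.minus_eq R.a_lcomm[of f "\<one>\<^bsub>R\<^esub>"] R.r_neg)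
  qed
  show ?thesis by (rule graded_NR_clean_group_ring_sum[OF assms(5,6)])
qed

end
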